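(* Let $\Bbbk$ be a countable totally ordered division ring, let $I$ and $J$ be countable sets with $I\subsetneq J$ and $J\setminus I$ infinite, let $K$ and $L$ be distributive $0$-lattices with $L$ countable and completely normal, let $\varphi\colon K\to L$ be a $0$-lattice homomorphism, and let $f\colon\mathrm{Id}_c\mathrm{F}_\ell(I,\Bbbk)\to K$ be a $0$-lattice homomorphism. Let $\eta_{I,J}\colon\mathrm{Id}_c\mathrm{F}_\ell(I,\Bbbk)\hookrightarrow\mathrm{Id}_c\mathrm{F}_\ell(J,\Bbbk)$ be the canonical embedding. Then there exists a surjective lattice homomorphism $g\colon\mathrm{Id}_c\mathrm{F}_\ell(J,\Bbbk)\twoheadrightarrow L$ such that $g\circ\eta_{I,J}=\varphi\circ f$.
   Context: A totally ordered division ring is a division ring with a compatible total order. A left vector lattice over $\Bbbk$ is a left $\Bbbk$-vector space with a lattice order making it an $\ell$-group such that $\lambda x\ge0$ whenever $\lambda\ge0$, $x\ge0$. $\mathrm{F}_\ell(I,\Bbbk)$ denotes the free left $\Bbbk$-vector lattice on the set $I$. An $\ell$-ideal of a vector lattice is an order-convex vector subspace closed under the lattice operations; $\mathrm{Id}_c F$ is the lattice of principal $\ell$-ideals of $F$ under inclusion. For $I\subseteq J$, $\eta_{I,J}$ is the map sending a principal $\ell$-ideal $\langle x\rangle$ of $\mathrm{F}_\ell(I,\Bbbk)$ to the principal $\ell$-ideal of $\mathrm{F}_\ell(J,\Bbbk)$ generated by the image of $x$ under the vector lattice homomorphism $\mathrm{F}_\ell(I,\Bbbk)\to\mathrm{F}_\ell(J,\Bbbk)$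 extending the inclusion $I\subseteq J$. A distributive $0$-lattice $D$ is completely normal if for all $a,b\in D$ there exist $x,y\in D$ with $a\vee b=a\vee y=x\vee b$ and $x\wedge y=0$. *)

theory Defs
  imports Complex_Main "HOL-Library.FuncSet" "HOL-Library.Countable_Set" "HOL-Library.Lub_Glb"
begin

section \<open>Left vector lattices\<close>

text \<open>
  The scalars form a type of sort \<open>{division_ring, linordered_ring}\<close>: a not necessarily
  commutative division ring with a compatible total order.

  The lattice order of a vector lattice is given by its join and meet operations;
  the order relation is recovered by \<open>vle\<close>.
\<close>

record ('k, 'a) vlat =
  vcar :: "'a set"
  vzero :: 'a
  vadd :: "'a \<Rightarrow> 'a \<Rightarrow> 'a"
  vneg :: "'a \<Rightarrow> 'a"
  vsmul :: "'k \<Rightarrow> 'a \<Rightarrow> 'a"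
  vjoin :: "'a \<Rightarrow> 'a \<Rightarrow> 'a"
  vmeet :: "'a \<Rightarrow> 'a \<Rightarrow> 'a"

definition vle :: "('k, 'a) vlat \<Rightarrow> 'a \<Rightarrow> 'a \<Rightarrow> bool" where
  "vle V x y \<longleftrightarrow> vjoin V x y = y"

locale vector_lattice =
  fixes V :: "('k::{division_ring,linordered_ring}, 'a) vlat"
  assumes zero_closed: "vzero V \<in> vcar V"
    and add_closed: "\<lbrakk>x \<in> vcar V; y \<in> vcar V\<rbrakk> \<Longrightarrow> vadd V x y \<in> vcar V"
    and neg_closed: "x \<in> vcar V \<Longrightarrow> vneg V x \<in> vcar V"
    and smul_closed: "x \<in> vcar V \<Longrightarrow> vsmul V a x \<in> vcar V"
    and join_closed: "\<lbrakk>x \<in> vcar V; y \<in> vcar V\<rbrakk> \<Longrightarrow> vjoin V x y \<in> vcar V"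
    and meet_closed: "\<lbrakk>x \<in> vcar V; y \<in> vcar V\<rbrakk> \<Longrightarrow> vmeet V x y \<in> vcar V"
    and add_assoc: "\<lbrakk>x \<in> vcar V; y \<in> vcar V; z \<in> vcar V\<rbrakk> \<Longrightarrow>
      vadd V (vadd V x y) z = vadd V x (vadd V y z)"
    and add_comm: "\<lbrakk>x \<in> vcar V; y \<in> vcar V\<rbrakk> \<Longrightarrow> vadd V x y = vadd V y x"
    and add_zero: "x \<in> vcar V \<Longrightarrow> vadd V x (vzero V) = x"
    and add_neg: "x \<in> vcar V \<Longrightarrow> vadd V x (vneg V x) = vzero V"
    and smul_add: "\<lbrakk>x \<in> vcar V; y \<in> vcar V\<rbrakk> \<Longrightarrow>
      vsmul V a (vadd V x y) = vadd V (vsmul V a x) (vsmul V a y)"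
    and add_smul: "x \<in> vcar V \<Longrightarrow> vsmul V (a + b) x = vadd V (vsmul V a x) (vsmul V b x)"
    and mult_smul: "x \<in> vcar V \<Longrightarrow> vsmul V (a * b) x = vsmul V a (vsmul V b x)"
    and one_smul: "x \<in> vcar V \<Longrightarrow> vsmul V 1 x = x"
    and join_comm: "\<lbrakk>x \<in> vcar V; y \<in> vcar V\<rbrakk> \<Longrightarrow> vjoin V x y = vjoin V y x"
    and join_assoc: "\<lbrakk>x \<in> vcar V; y \<in> vcar V; z \<in> vcar V\<rbrakk> \<Longrightarrow>
      vjoin V (vjoin V x y) z = vjoin V x (vjoin V y z)"
    and meet_comm: "\<lbrakk>x \<in> vcar V; y \<in> vcar V\<rbrakk> \<Longrightarrow> vmeet V x y = vmeet V y x"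
    and meet_assoc: "\<lbrakk>x \<in> vcar V; y \<in> vcar V; z \<in> vcar V\<rbrakk> \<Longrightarrow>
      vmeet V (vmeet V x y) z = vmeet V x (vmeet V y z)"
    and join_meet_absorb: "\<lbrakk>x \<in> vcar V; y \<in> vcar V\<rbrakk> \<Longrightarrow> vjoin V x (vmeet V x y) = x"
    and meet_join_absorb: "\<lbrakk>x \<in> vcar V; y \<in> vcar V\<rbrakk> \<Longrightarrow> vmeet V x (vjoin V x y) = x"
    and add_mono: "\<lbrakk>x \<in> vcar V; y \<in> vcar V; z \<in> vcar V; vle V x y\<rbrakk> \<Longrightarrow>
      vle V (vadd V x z) (vadd V y z)"
    and smul_nonneg: "\<lbrakk>x \<in> vcar V; 0 \<le> a; vle V (vzero V) x\<rbrakk> \<Longrightarrow> vle V (vzero V) (vsmul V a x)"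

definition vl_hom :: "('k, 'a) vlat \<Rightarrow> ('k, 'b) vlat \<Rightarrow> ('a \<Rightarrow> 'b) \<Rightarrow> bool" where
  "vl_hom U V h \<longleftrightarrow>
     h \<in> vcar U \<rightarrow> vcar V \<and>
     h (vzero U) = vzero V \<and>
     (\<forall>x\<in>vcar U. \<forall>y\<in>vcar U. h (vadd U x y) = vadd V (h x) (h y)) \<and>
     (\<forall>x\<in>vcar U. h (vneg U x) = vneg V (h x)) \<and>
     (\<forall>a. \<forall>x\<in>vcar U. h (vsmul U a x) = vsmul V a (h x)) \<and>
     (\<forall>x\<in>vcar U. \<forall>y\<in>vcar U. h (vjoin U x y) = vjoin V (h x) (h y)) \<and>
     (\<forall>x\<in>vcar U. \<forall>y\<in>vcar U. h (vmeet U x y) = vmeet V (h x) (h y))"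

definition l_ideal :: "('k, 'a) vlat \<Rightarrow> 'a set \<Rightarrow> bool" where
  "l_ideal V A \<longleftrightarrow>
     A \<subseteq> vcar V \<and>
     vzero V \<in> A \<and>
     (\<forall>x\<in>A. \<forall>y\<in>A. vadd V x y \<in> A) \<and>
     (\<forall>a. \<forall>x\<in>A. vsmul V a x \<in> A) \<and>
     (\<forall>x\<in>A. \<forall>y\<in>A. vjoin V x y \<in> A) \<and>
     (\<forall>x\<in>A. \<forall>y\<in>A. vmeet V x y \<in> A) \<and>
     (\<forall>x\<in>A. \<forall>y\<in>A. \<forall>z\<in>vcar V. vle V x z \<and> vle V z y \<longrightarrow> z \<in> A)"

definition principal_ideal :: "('k, 'a) vlat \<Rightarrow> 'a \<Rightarrow> 'a set" where
  "principal_ideal V x = \<Inter> {A. l_ideal V A \<and> x \<in> A}"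

definition Idc :: "('k, 'a) vlat \<Rightarrow> 'a set set" where
  "Idc V = principal_ideal V ` vcar V"


section \<open>Free left vector lattices\<close>

datatype (vars: 'i, 'k) vlterm =
    Var 'i
  | Zero
  | Add "('i, 'k) vlterm" "('i, 'k) vlterm"
  | Neg "('i, 'k) vlterm"
  | Smul 'k "('i, 'k) vlterm"
  | Join "('i, 'k) vlterm" "('i, 'k) vlterm"
  | Meet "('i, 'k) vlterm" "('i, 'k) vlterm"

text \<open>
  The least congruence on terms whose quotient satisfies the axioms of left vector lattices.
\<close>

inductive vleq ::
  "('i, 'k::{division_ring,linordered_ring}) vlterm \<Rightarrow> ('i, 'k) vlterm \<Rightarrow> bool" where
  vleq_refl: "vleq s s"
| vleq_sym: "vleq s t \<Longrightarrow> vleq t s"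
| vleq_trans: "vleq s t \<Longrightarrow> vleq t u \<Longrightarrow> vleq s u"
| cong_Add: "vleq s s' \<Longrightarrow> vleq t t' \<Longrightarrow> vleq (Add s t) (Add s' t')"
| cong_Neg: "vleq s s' \<Longrightarrow> vleq (Neg s) (Neg s')"
| cong_Smul: "vleq s s' \<Longrightarrow> vleq (Smul a s) (Smul a s')"
| cong_Join: "vleq s s' \<Longrightarrow> vleq t t' \<Longrightarrow> vleq (Join s t) (Join s' t')"
| cong_Meet: "vleq s s' \<Longrightarrow> vleq t t' \<Longrightarrow> vleq (Meet s t) (Meet s' t')"
| ax_add_assoc: "vleq (Add (Add s t) u) (Add s (Add t u))"
| ax_add_comm: "vleq (Add s t) (Add t s)"
| ax_add_zero: "vleq (Add s Zero) s"
| ax_add_neg: "vleq (Add s (Neg s)) Zero"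
| ax_smul_add: "vleq (Smul a (Add s t)) (Add (Smul a s) (Smul a t))"
| ax_add_smul: "vleq (Smul (a + b) s) (Add (Smul a s) (Smul b s))"
| ax_mult_smul: "vleq (Smul (a * b) s) (Smul a (Smul b s))"
| ax_one_smul: "vleq (Smul 1 s) s"
| ax_join_comm: "vleq (Join s t) (Join t s)"
| ax_join_assoc: "vleq (Join (Join s t) u) (Join s (Join t u))"
| ax_meet_comm: "vleq (Meet s t) (Meet t s)"
| ax_meet_assoc: "vleq (Meet (Meet s t) u) (Meet s (Meet t u))"
| ax_join_meet: "vleq (Join s (Meet s t)) s"
| ax_meet_join: "vleq (Meet s (Join s t)) s"
| ax_add_mono: "vleq (Join s t) t \<Longrightarrow> vleq (Join (Add s u) (Add t u)) (Add t u)"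
| ax_smul_nonneg: "0 \<le> a \<Longrightarrow> vleq (Join Zero s) s \<Longrightarrow> vleq (Join Zero (Smul a s)) (Smul a s)"

quotient_type (overloaded) ('i, 'k) fvl =
  "('i, 'k::{division_ring,linordered_ring}) vlterm" / vleq
  by (intro equivpI reflpI sympI transpI) (auto intro: vleq_refl vleq_sym vleq_trans)

lift_definition fgen :: "'i \<Rightarrow> ('i, 'k::{division_ring,linordered_ring}) fvl" is Var .
lift_definition fzero :: "('i, 'k::{division_ring,linordered_ring}) fvl" is Zero .
lift_definition fadd :: "('i, 'k::{division_ring,linordered_ring}) fvl \<Rightarrow> ('i, 'k) fvl \<Rightarrow> ('i, 'k) fvl"
  is Add by (rule cong_Add)
lift_definition fneg :: "('i, 'k::{division_ring,linordered_ring}) fvl \<Rightarrow> ('i, 'k) fvl"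
  is Neg by (rule cong_Neg)
lift_definition fsmul :: "'k::{division_ring,linordered_ring} \<Rightarrow> ('i, 'k) fvl \<Rightarrow> ('i, 'k) fvl"
  is Smul by (rule cong_Smul)
lift_definition fjoin :: "('i, 'k::{division_ring,linordered_ring}) fvl \<Rightarrow> ('i, 'k) fvl \<Rightarrow> ('i, 'k) fvl"
  is Join by (rule cong_Join)
lift_definition fmeet :: "('i, 'k::{division_ring,linordered_ring}) fvl \<Rightarrow> ('i, 'k) fvl \<Rightarrow> ('i, 'k) fvl"
  is Meet by (rule cong_Meet)

text \<open>
  The free left vector lattice on \<open>I\<close>, as classes of terms with variables in \<open>I\<close>. The
  congruence lives on terms over the whole type \<open>'i\<close>; that this gives the free object on \<open>I\<close>
  is \<open>free_vl_universal\<close> below.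
\<close>

definition free_vl :: "'i set \<Rightarrow> ('k::{division_ring,linordered_ring}, ('i, 'k) fvl) vlat" where
  "free_vl I = \<lparr>vcar = abs_fvl ` {t. vars t \<subseteq> I}, vzero = fzero, vadd = fadd, vneg = fneg,
     vsmul = fsmul, vjoin = fjoin, vmeet = fmeet\<rparr>"

lemma free_vl_simps [simp]:
  "vcar (free_vl I) = abs_fvl ` {t. vars t \<subseteq> I}"
  "vzero (free_vl I) = fzero" "vadd (free_vl I) = fadd" "vneg (free_vl I) = fneg"
  "vsmul (free_vl I) = fsmul" "vjoin (free_vl I) = fjoin" "vmeet (free_vl I) = fmeet"
  by (simp_all add: free_vl_def)

lemma abs_fvl_simps:
  "fzero = abs_fvl Zero"
  "fgen i = abs_fvl (Var i)"
  "fadd (abs_fvl s) (abs_fvl t) = abs_fvl (Add s t)"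
  "fneg (abs_fvl s) = abs_fvl (Neg s)"
  "fsmul a (abs_fvl s) = abs_fvl (Smul a s)"
  "fjoin (abs_fvl s) (abs_fvl t) = abs_fvl (Join s t)"
  "fmeet (abs_fvl s) (abs_fvl t) = abs_fvl (Meet s t)"
  by (simp_all add: fzero.abs_eq fgen.abs_eq fadd.abs_eq fneg.abs_eq fsmul.abs_eq fjoin.abs_eq
      fmeet.abs_eq vleq_refl)

lemma abs_fvl_eq_iff: "abs_fvl s = abs_fvl t \<longleftrightarrow> vleq s t"
  by (rule fvl.abs_eq_iff)

lemma vector_lattice_free_vl:
  "vector_lattice (free_vl I :: ('k::{division_ring,linordered_ring}, ('i, 'k) fvl) vlat)"
  (is "vector_lattice ?F")
proof -
  have car: "x \<in> vcar ?F \<longleftrightarrow> (\<exists>t. x = abs_fvl t \<and> vars t \<subseteq> I)" for x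
    by auto
  have car': "\<exists>s. vleq t s \<and> vars s \<subseteq> I" if "vars t \<subseteq> I" for t :: "('i, 'k) vlterm"
    using that vleq_refl by blast
  note [simp del] = free_vl_simps(1)
  show ?thesis
    by unfold_locales
      (auto simp: abs_fvl_simps car abs_fvl_eq_iff vle_def intro: vleq.intros intro!: car' del: subsetI)
qed

lemma fgen_in_free_vl: "i \<in> I \<Longrightarrow> fgen i \<in> vcar (free_vl I)"
  by (auto simp: abs_fvl_simps)

primrec term_eval :: "('k, 'a) vlat \<Rightarrow> ('i \<Rightarrow> 'a) \<Rightarrow> ('i, 'k) vlterm \<Rightarrow> 'a" where
  "term_eval V v (Var i) = v i"
| "term_eval V v Zero = vzero V"
| "term_eval V v (Add s t) = vadd V (term_eval V v s) (term_eval V v t)"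
| "term_eval V v (Neg s) = vneg V (term_eval V v s)"
| "term_eval V v (Smul a s) = vsmul V a (term_eval V v s)"
| "term_eval V v (Join s t) = vjoin V (term_eval V v s) (term_eval V v t)"
| "term_eval V v (Meet s t) = vmeet V (term_eval V v s) (term_eval V v t)"

lemma (in vector_lattice) term_eval_closed:
  "(\<And>i. i \<in> vars t \<Longrightarrow> v i \<in> vcar V) \<Longrightarrow> term_eval V v t \<in> vcar V"
  by (induction t)
    (auto intro: zero_closed add_closed neg_closed smul_closed join_closed meet_closed)

lemma (in vector_lattice) term_eval_vleq:
  assumes v: "\<And>i. v i \<in> vcar V" and "vleq s t"
  shows "term_eval V v s = term_eval V v t"
proof -
  have c: "term_eval V v u \<in> vcar V" for u
    by (rule term_eval_closed) (rule v)
  show ?thesis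
    using \<open>vleq s t\<close>
  proof (induction rule: vleq.induct)
    case (ax_add_comm s t) show ?case by (simp add: add_comm c)
  next
    case (ax_join_comm s t) show ?case by (simp add: join_comm c)
  next
    case (ax_meet_comm s t) show ?case by (simp add: meet_comm c)
  next
    case (ax_add_mono s t u)
    then show ?case using add_mono[of "term_eval V v s" "term_eval V v t" "term_eval V v u"]
      by (simp add: vle_def c)
  next
    case (ax_smul_nonneg a s)
    then show ?case using smul_nonneg[of "term_eval V v s" a] by (simp add: vle_def c)
  qed (simp_all add: c add_assoc add_zero add_neg smul_add add_smul mult_smul one_smul
      join_assoc meet_assoc join_meet_absorb meet_join_absorb)
qed

lemma vl_hom_free_unique:
  assumes "vl_hom (free_vl I) V g" "vl_hom (free_vl I) V h"
    and "\<forall>i\<in>I. g (fgen i) = h (fgen i)" and "vars t \<subseteq> I"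
  shows "g (abs_fvl t) = h (abs_fvl t)"
  using assms(4)
proof (induction t)
  case (Var i) then show ?case using assms(3) by (simp add: abs_fvl_simps)
next
  case Zero then show ?case using assms(1,2) by (simp add: vl_hom_def abs_fvl_simps)
next
  case (Add s t)
  then show ?case using assms(1,2) by (simp add: vl_hom_def flip: abs_fvl_simps)
next
  case (Neg s)
  then show ?case using assms(1,2) by (simp add: vl_hom_def flip: abs_fvl_simps)
next
  case (Smul a s)
  then show ?case using assms(1,2) by (simp add: vl_hom_def flip: abs_fvl_simps)
next
  case (Join s t)
  then show ?case using assms(1,2) by (simp add: vl_hom_def flip: abs_fvl_simps)
next
  case (Meet s t)
  then show ?case using assms(1,2) by (simp add: vl_hom_def flip: abs_fvl_simps)
qed

theorem free_vl_universal:
  fixes V :: "('k::{division_ring,linordered_ring}, 'a) vlat" and I :: "'i set"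
  assumes "vector_lattice V" and v: "v \<in> I \<rightarrow> vcar V"
  shows "\<exists>!h. h \<in> extensional (vcar (free_vl I)) \<and> vl_hom (free_vl I) V h \<and>
    (\<forall>i\<in>I. h (fgen i) = v i)"
proof -
  interpret vector_lattice V by fact
  define w where "w i = (if i \<in> I then v i else vzero V)" for i
  have w: "w i \<in> vcar V" for i
    using v by (auto simp: w_def zero_closed)
  have c: "term_eval V w t \<in> vcar V" for t
    by (rule term_eval_closed) (rule w)
  define h where "h = restrict (\<lambda>x. term_eval V w (rep_fvl x)) (vcar (free_vl I))"
  have h: "h (abs_fvl t) = term_eval V w t" if "vars t \<subseteq> I" for t
  proof -
    have "vleq (rep_fvl (abs_fvl t)) t"
      by (simp add: abs_fvl_eq_iff[symmetric] Quotient_abs_rep[OF Quotient_fvl])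
    then show ?thesis
      using that term_eval_vleq[OF w] by (auto simp: h_def)
  qed
  have hom: "vl_hom (free_vl I) V h"
    unfolding vl_hom_def by (auto simp: abs_fvl_simps h c)
  have ext: "\<forall>i\<in>I. h (fgen i) = v i"
    by (simp add: abs_fvl_simps h w_def)
  show ?thesis
  proof (rule ex1I[of _ h])
    show "h \<in> extensional (vcar (free_vl I)) \<and> vl_hom (free_vl I) V h \<and> (\<forall>i\<in>I. h (fgen i) = v i)"
      using hom ext by (auto simp: h_def)
  next
    fix g assume g: "g \<in> extensional (vcar (free_vl I)) \<and> vl_hom (free_vl I) V g \<and>
      (\<forall>i\<in>I. g (fgen i) = v i)"
    show "g = h"
    proof (rule extensionalityI)
      show "g \<in> extensional (vcar (free_vl I))" using g by blast
      show "h \<in> extensional (vcar (free_vl I))" by (simp add: h_def)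
      fix x assume "x \<in> vcar (free_vl I :: ('k, ('i, 'k) fvl) vlat)"
      then show "g x = h x"
        using vl_hom_free_unique[of I V g h] g hom ext by auto
    qed
  qed
qed

definition free_incl ::
  "'i set \<Rightarrow> 'i set \<Rightarrow> ('i, 'k::{division_ring,linordered_ring}) fvl \<Rightarrow> ('i, 'k) fvl" where
  "free_incl I J = (THE h. h \<in> extensional (vcar (free_vl I)) \<and>
     vl_hom (free_vl I) (free_vl J) h \<and> (\<forall>i\<in>I. h (fgen i) = fgen i))"

lemma free_incl:
  assumes "I \<subseteq> J"
  shows "vl_hom (free_vl I) (free_vl J) (free_incl I J)"
    and "i \<in> I \<Longrightarrow> free_incl I J (fgen i) = fgen i"
proof -
  have "fgen \<in> I \<rightarrow> vcar (free_vl J)"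
    by (intro funcsetI fgen_in_free_vl subsetD[OF assms])
  note * = theI'[OF free_vl_universal[OF vector_lattice_free_vl this], folded free_incl_def]
  show "vl_hom (free_vl I) (free_vl J) (free_incl I J)"
    by (rule *[THEN conjunct2, THEN conjunct1])
  show "i \<in> I \<Longrightarrow> free_incl I J (fgen i) = fgen i"
    by (rule *[THEN conjunct2, THEN conjunct2, rule_format])
qed

definition eta :: "'i set \<Rightarrow> 'i set \<Rightarrow>
    ('i, 'k::{division_ring,linordered_ring}) fvl set \<Rightarrow> ('i, 'k) fvl set" where
  "eta I J A = (THE B. \<exists>x\<in>vcar (free_vl I).
     A = principal_ideal (free_vl I) x \<and> B = principal_ideal (free_vl J) (free_incl I J x))"

lemma l_ideal_vimage:
  assumes "vector_lattice U" and h: "vl_hom U V h" and A: "l_ideal V A"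
  shows "l_ideal U {x \<in> vcar U. h x \<in> A}"
proof -
  interpret vector_lattice U by fact
  have "vle V (h x) (h y)" if "vle U x y" "x \<in> vcar U" "y \<in> vcar U" for x y
    using that h unfolding vle_def vl_hom_def by metis
  moreover have "h x \<in> vcar V" if "x \<in> vcar U" for x
    using that h unfolding vl_hom_def by blast
  ultimately have convex: "z \<in> {x \<in> vcar U. h x \<in> A}"
    if "x \<in> {x \<in> vcar U. h x \<in> A}" "y \<in> {x \<in> vcar U. h x \<in> A}" "z \<in> vcar U"
      "vle U x z" "vle U z y" for x y z
    using that A unfolding l_ideal_def by blast
  show ?thesis
    unfolding l_ideal_def
  proof (intro conjI ballI allI impI)
    show "{x \<in> vcar U. h x \<in> A} \<subseteq> vcar U" by blast
    show "vzero U \<in> {x \<in> vcar U. h x \<in> A}"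
      using h A zero_closed by (simp add: vl_hom_def l_ideal_def)
  next
    fix x y assume "x \<in> {x \<in> vcar U. h x \<in> A}" "y \<in> {x \<in> vcar U. h x \<in> A}"
    then show "vadd U x y \<in> {x \<in> vcar U. h x \<in> A}"
      and "vjoin U x y \<in> {x \<in> vcar U. h x \<in> A}"
      and "vmeet U x y \<in> {x \<in> vcar U. h x \<in> A}"
      using h A add_closed join_closed meet_closed by (simp_all add: vl_hom_def l_ideal_def)
  next
    fix a x assume "x \<in> {x \<in> vcar U. h x \<in> A}"
    then show "vsmul U a x \<in> {x \<in> vcar U. h x \<in> A}"
      using h A smul_closed by (simp add: vl_hom_def l_ideal_def)
  next
    fix x y z
    assume "x \<in> {x \<in> vcar U. h x \<in> A}" "y \<in> {x \<in> vcar U. h x \<in> A}" "z \<in> vcar U"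
      "vle U x z \<and> vle U z y"
    then show "z \<in> {x \<in> vcar U. h x \<in> A}"
      using convex by blast
  qed
qed

lemma principal_hom_mono:
  assumes "vector_lattice U" and h: "vl_hom U V h" and y: "y \<in> vcar U"
    and x: "x \<in> principal_ideal U y"
  shows "principal_ideal V (h x) \<subseteq> principal_ideal V (h y)"
proof -
  have "h x \<in> A" if "l_ideal V A" "h y \<in> A" for A
  proof -
    have "x \<in> {x \<in> vcar U. h x \<in> A}"
      using x l_ideal_vimage[OF assms(1) h that(1)] that(2) y
      unfolding principal_ideal_def by blast
    then show ?thesis by simp
  qed
  then show ?thesis unfolding principal_ideal_def by fast
qed

lemma principal_hom_eq:
  assumes "vector_lattice U" and h: "vl_hom U V h" and x: "x \<in> vcar U" and y: "y \<in> vcar U"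
    and eq: "principal_ideal U x = principal_ideal U y"
  shows "principal_ideal V (h x) = principal_ideal V (h y)"
proof -
  have "z \<in> principal_ideal U z" for z by (simp add: principal_ideal_def)
  then have "x \<in> principal_ideal U y" "y \<in> principal_ideal U x"
    using eq by auto
  then show ?thesis
    using principal_hom_mono[OF assms(1) h] x y by (intro subset_antisym)
qed

lemma eta_principal:
  assumes "I \<subseteq> J" and "x \<in> vcar (free_vl I)"
  shows "eta I J (principal_ideal (free_vl I) x) = principal_ideal (free_vl J) (free_incl I J x)"
  unfolding eta_def
proof (rule the_equality)
  show "\<exists>y\<in>vcar (free_vl I). principal_ideal (free_vl I) x = principal_ideal (free_vl I) y \<and>
      principal_ideal (free_vl J) (free_incl I J x) = principal_ideal (free_vl J) (free_incl I J y)"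
    using assms(2) by blast
next
  fix B
  assume "\<exists>y\<in>vcar (free_vl I). principal_ideal (free_vl I) x = principal_ideal (free_vl I) y \<and>
      B = principal_ideal (free_vl J) (free_incl I J y)"
  then obtain y where y: "y \<in> vcar (free_vl I)"
    "principal_ideal (free_vl I) x = principal_ideal (free_vl I) y"
    "B = principal_ideal (free_vl J) (free_incl I J y)"
    by blast
  show "B = principal_ideal (free_vl J) (free_incl I J x)"
    unfolding y(3)
    by (rule principal_hom_eq[OF vector_lattice_free_vl free_incl(1)[OF assms(1)] y(1) assms(2)])
      (rule y(2)[symmetric])
qed


section \<open>Homomorphisms of 0-lattices\<close>

text \<open>
  The source of the homomorphisms below is a subset \<open>S\<close> of an ordered type that is a lattice
  in the induced order, such as \<open>Idc V\<close> ordered by inclusion, with joins and meets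
  computed in \<open>S\<close>.
\<close>

definition lattice_hom_on :: "'a::order set \<Rightarrow> ('a \<Rightarrow> 'b::lattice) \<Rightarrow> bool" where
  "lattice_hom_on S h \<longleftrightarrow>
     (\<forall>x\<in>S. \<forall>y\<in>S. \<forall>z. isLub S {x, y} z \<longrightarrow> h z = sup (h x) (h y)) \<and>
     (\<forall>x\<in>S. \<forall>y\<in>S. \<forall>z. isGlb S {x, y} z \<longrightarrow> h z = inf (h x) (h y))"

definition zero_lattice_hom_on ::
  "'a::order set \<Rightarrow> ('a \<Rightarrow> 'b::bounded_lattice_bot) \<Rightarrow> bool" where
  "zero_lattice_hom_on S h \<longleftrightarrow>
     lattice_hom_on S h \<and> (\<forall>z\<in>S. (\<forall>x\<in>S. z \<le> x) \<longrightarrow> h z = bot)"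

lemma zero_lattice_hom_on_UNIV:
  "zero_lattice_hom_on UNIV (h :: 'a::bounded_lattice_bot \<Rightarrow> 'b::bounded_lattice_bot) \<longleftrightarrow>
     (\<forall>x y. h (sup x y) = sup (h x) (h y)) \<and> (\<forall>x y. h (inf x y) = inf (h x) (h y)) \<and>
     h bot = bot"
proof -
  have lub: "isLub UNIV {x, y} z \<longleftrightarrow> z = sup x y" for x y z :: 'a
    by (auto simp: isLub_def leastP_def isUb_def setle_def setge_def intro: antisym)
  have glb: "isGlb UNIV {x, y} z \<longleftrightarrow> z = inf x y" for x y z :: 'a
    by (auto simp: isGlb_def greatestP_def isLb_def setle_def setge_def intro: antisym)
  have bot: "(\<forall>x. z \<le> x) \<longleftrightarrow> z = bot" for z :: 'a
    by (metis bot.extremum bot.extremum_uniqueI)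
  show ?thesis
    by (simp add: zero_lattice_hom_on_def lattice_hom_on_def lub glb bot)
qed

class completely_normal_lattice = distrib_lattice + bounded_lattice_bot +
  assumes completely_normal:
    "\<exists>x y. sup a b = sup a y \<and> sup a b = sup x b \<and> inf x y = bot"

end

theory Submission
  imports Defs "HOL-Library.Lattice_Algebras"
begin

text \<open>
  A \<open>0\<close>-lattice homomorphism from \<open>Idc (free_vl I)\<close> is determined by the map
  \<open>h a = \<langle>a\<^sup>+\<rangle>\<close> on the linear span of \<open>I\<close>, and such maps are characterised by
  \<open>h a \<sqinter> h (-a) = 0\<close>, \<open>h (a + b) \<le> h a \<squnion> h b\<close> and \<open>h (k a) = h a\<close> for \<open>k > 0\<close>. Indeed, for each
  prime filter \<open>P\<close> of the target, \<open>{a. h a \<in> P}\<close> is the set of strictly positive elements of a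
  total preorder, so that the free vector lattice maps to a totally ordered space; since every
  element is a join of meets of linear ones, the prime filters at which it is nonzero come from
  an element of the target. It remains to extend \<open>h\<close> from the span of \<open>I\<close> to that of \<open>J\<close>, one
  variable \<open>x\<close> at a time. This amounts to choosing values \<open>u c\<close>, \<open>v c\<close> for \<open>x > c\<close> and \<open>x < c\<close>, for
  all \<open>c\<close> in a countable space, subject to
  \<^item> \<open>u c \<sqinter> v c = 0\<close> and \<open>h (d - c) \<le> u c \<squnion> v d\<close>,
  \<^item> \<open>u c \<le> h (d - c) \<squnion> u d\<close> and \<open>v c \<le> h (c - d) \<squnion> v d\<close>.
  Complete normality allows one to choose them one \<open>c\<close> after the other. The first value \<open>u 0\<close> is
  arbitrary, which gives surjectivity.
\<close>

section \<open>Prime filters of distributive lattices\<close>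

text \<open>The complements are the prime ideals containing \<open>bot\<close>, the whole lattice
  among them. The empty set therefore counts as a prime filter. It is harmless, since every
  membership statement is false there.\<close>

definition prime_filter :: "'l::{distrib_lattice,bounded_lattice_bot} set \<Rightarrow> bool" where
  "prime_filter P \<longleftrightarrow> bot \<notin> P \<and> (\<forall>x y. sup x y \<in> P \<longleftrightarrow> x \<in> P \<or> y \<in> P) \<and>
    (\<forall>x y. inf x y \<in> P \<longleftrightarrow> x \<in> P \<and> y \<in> P)"

lemma prime_filterD:
  assumes "prime_filter P"
  shows "sup x y \<in> P \<longleftrightarrow> x \<in> P \<or> y \<in> P" "inf x y \<in> P \<longleftrightarrow> x \<in> P \<and> y \<in> P" "bot \<notin> P"
  using assms by (simp_all add: prime_filter_def)

lemma prime_filter_mono: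
  assumes "prime_filter P" "x \<le> y" "x \<in> P"
  shows "y \<in> P"
  using prime_filterD(1)[OF assms(1), of x y] assms(2,3) by (simp add: sup_absorb2)

text \<open>Zorn's lemma gives an ideal \<open>M\<close> that is maximal among those containing
  \<open>b\<close> and avoiding \<open>a\<close>. Distributivity makes it prime, and its complement
  is the required filter.\<close>

lemma prime_filter_separation:
  fixes a b :: "'l::{distrib_lattice,bounded_lattice_bot}"
  assumes "\<not> a \<le> b"
  obtains P where "prime_filter P" "a \<in> P" "b \<notin> P"
proof -
  define A where "A = {M :: 'l set. b \<in> M \<and> a \<notin> M \<and>
    (\<forall>x\<in>M. \<forall>y\<in>M. sup x y \<in> M) \<and> (\<forall>x\<in>M. \<forall>y\<le>x. y \<in> M)}"
  have "{x. x \<le> b} \<in> A"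
    using assms by (auto simp: A_def intro: order_trans)
  then have "A \<noteq> {}" by blast
  have "\<Union>\<C> \<in> A" if \<C>: "\<C> \<noteq> {}" "subset.chain A \<C>" for \<C>
  proof -
    have D: "b \<in> X" "a \<notin> X" "\<And>x y. x \<in> X \<Longrightarrow> y \<in> X \<Longrightarrow> sup x y \<in> X"
      "\<And>x y. x \<in> X \<Longrightarrow> y \<le> x \<Longrightarrow> y \<in> X" if "X \<in> \<C>" for X
      using that \<C>(2) unfolding subset_chain_def A_def by blast+
    show ?thesis
      unfolding A_def mem_Collect_eq
    proof (intro conjI ballI allI impI)
      show "b \<in> \<Union>\<C>" "a \<notin> \<Union>\<C>"
        using D(1,2) \<C>(1) by blast+
    next
      fix x y assume "x \<in> \<Union>\<C>" "y \<in> \<Union>\<C>"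
      then obtain X Y where XY: "x \<in> X" "y \<in> Y" "X \<in> \<C>" "Y \<in> \<C>" by blast
      then have "X \<subseteq> Y \<or> Y \<subseteq> X"
        using \<C>(2) by (auto simp: subset_chain_def)
      then show "sup x y \<in> \<Union>\<C>" using D(3) XY by blast
    next
      fix x y assume "x \<in> \<Union>\<C>" "y \<le> x"
      then show "y \<in> \<Union>\<C>" using D(4) by blast
    qed
  qed
  then have "\<exists>M\<in>A. \<forall>X\<in>A. M \<subseteq> X \<longrightarrow> X = M"
    using \<open>A \<noteq> {}\<close> by (intro subset_Zorn_nonempty)
  then obtain M where M: "M \<in> A" and max: "\<And>X. X \<in> A \<Longrightarrow> M \<subseteq> X \<Longrightarrow> X = M"
    by blast
  have sup_M: "\<And>x y. x \<in> M \<Longrightarrow> y \<in> M \<Longrightarrow> sup x y \<in> M" and down: "\<And>x y. x \<in> M \<Longrightarrow> y \<le> x \<Longrightarrow> y \<in> M"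
    and M': "b \<in> M" "a \<notin> M"
    using M by (auto simp: A_def)
  \<comment> \<open>Otherwise the ideal generated by \<open>M\<close> and \<open>x\<close> would
    still avoid \<open>a\<close>, against maximality.\<close>
  have ext: "\<exists>m\<in>M. a \<le> sup m x" if "x \<notin> M" for x
  proof (rule ccontr)
    assume no: "\<not> ?thesis"
    let ?X = "{y. \<exists>m\<in>M. y \<le> sup m x}"
    have "?X \<in> A"
      unfolding A_def
    proof (intro CollectI conjI ballI allI impI)
      show "\<exists>m\<in>M. b \<le> sup m x"
        using M'(1) by (intro bexI[of _ b]) simp_all
      show "a \<notin> ?X" using no by blast
    next
      fix y z assume "y \<in> ?X" "z \<in> ?X"
      then obtain m n where mn: "m \<in> M" "n \<in> M" and "y \<le> sup m x" "z \<le> sup n x"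
        by blast
      then have "sup y z \<le> sup (sup m x) (sup n x)"
        by (intro sup_mono)
      then have "sup y z \<le> sup (sup m n) x"
        by (simp add: sup_commute sup_left_commute)
      then show "\<exists>m\<in>M. sup y z \<le> sup m x" using sup_M mn by blast
    next
      fix y z assume "y \<in> ?X" "z \<le> y"
      then show "\<exists>m\<in>M. z \<le> sup m x" using order_trans[of z y] by blast
    qed
    moreover have "M \<subseteq> ?X"
    proof
      fix m assume "m \<in> M"
      then show "m \<in> ?X" by (intro CollectI bexI[of _ m]) simp_all
    qed
    ultimately have "?X = M" by (rule max)
    moreover have "x \<in> ?X"
      using M'(1) by (intro CollectI bexI[of _ b]) simp_all
    ultimately show False using that by blast
  qed
  have "x \<in> M \<or> y \<in> M" if xy: "inf x y \<in> M" for x y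
  proof (rule ccontr)
    assume "\<not> ?thesis"
    then obtain m n where mn: "m \<in> M" "n \<in> M" "a \<le> sup m x" "a \<le> sup n y"
      using ext by blast
    have "a \<le> sup (sup m n) x"
      using mn(3) by (rule order_trans) (intro sup_mono sup_ge1 order_refl)
    moreover have "a \<le> sup (sup m n) y"
      using mn(4) by (rule order_trans) (intro sup_mono sup_ge2 order_refl)
    \<comment> \<open>Distributivity turns the two bounds on \<open>a\<close> into one whose
      right-hand side lies in \<open>M\<close>.\<close>
    ultimately have "a \<le> inf (sup (sup m n) x) (sup (sup m n) y)"
      by (rule inf_greatest)
    then have "a \<le> sup (sup m n) (inf x y)"
      by (simp add: sup_inf_distrib1)
    then have "a \<in> M"
      by (rule down[OF sup_M[OF sup_M[OF mn(1,2)] xy]])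
    then show False using M'(2) by blast
  qed
  then have "inf x y \<in> M \<longleftrightarrow> x \<in> M \<or> y \<in> M" for x y
    using down[OF _ inf_le1] down[OF _ inf_le2] by blast
  moreover have "sup x y \<in> M \<longleftrightarrow> x \<in> M \<and> y \<in> M" for x y
    using down[OF _ sup_ge1] down[OF _ sup_ge2] sup_M by blast
  moreover have "bot \<in> M"
    by (rule down[OF M'(1) bot_least])
  ultimately have "prime_filter (- M)"
    by (simp add: prime_filter_def)
  then show thesis
    by (rule that) (use M' in simp_all)
qed

lemma le_iff_prime_filter:
  fixes a b :: "'l::{distrib_lattice,bounded_lattice_bot}"
  shows "a \<le> b \<longleftrightarrow> (\<forall>P. prime_filter P \<longrightarrow> a \<in> P \<longrightarrow> b \<in> P)"
proof
  assume "a \<le> b"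
  then show "\<forall>P. prime_filter P \<longrightarrow> a \<in> P \<longrightarrow> b \<in> P"
    by (blast intro: prime_filter_mono)
next
  assume *: "\<forall>P. prime_filter P \<longrightarrow> a \<in> P \<longrightarrow> b \<in> P"
  show "a \<le> b"
  proof (rule ccontr)
    assume "\<not> a \<le> b"
    then show False
      by (rule prime_filter_separation) (use * in simp)
  qed
qed

lemma prime_filter_eqI:
  fixes a b :: "'l::{distrib_lattice,bounded_lattice_bot}"
  assumes "\<And>P. prime_filter P \<Longrightarrow> a \<in> P \<longleftrightarrow> b \<in> P"
  shows "a = b"
  using le_iff_prime_filter[of a b] le_iff_prime_filter[of b a] assms by (auto intro: antisym)

text \<open>The lattice may have no top, so the meet has to run over a nonempty range;
  \<open>e \<le> n\<close> always includes \<open>e = 0\<close>.\<close>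

lemma finite_meet_prime_filter:
  fixes F :: "nat \<Rightarrow> 'l::{distrib_lattice,bounded_lattice_bot}"
  obtains u where "\<And>P. prime_filter P \<Longrightarrow> u \<in> P \<longleftrightarrow> (\<forall>e\<le>n. F e \<in> P)"
proof -
  have "\<exists>u. \<forall>P. prime_filter P \<longrightarrow> (u \<in> P \<longleftrightarrow> (\<forall>e\<le>n. F e \<in> P))"
  proof (induction n)
    case (Suc n)
    then obtain u where "\<forall>P. prime_filter P \<longrightarrow> (u \<in> P \<longleftrightarrow> (\<forall>e\<le>n. F e \<in> P))" by blast
    then show ?case
      by (intro exI[of _ "inf u (F (Suc n))"]) (auto simp: prime_filterD le_Suc_eq)
  qed auto
  then show thesis using that by blast
qed


section \<open>Extending valuations by one dimension\<close>

lemma one_pos: "(0::'k::{division_ring,linordered_ring}) < 1"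
  using zero_le_square[of "1::'k"] by (simp add: less_le)

lemma mult_pos:
  fixes a b :: "'k::{division_ring,linordered_ring}"
  assumes "0 < a" "0 < b"
  shows "0 < a * b"
  using mult_nonneg_nonneg[of a b] assms by (simp add: less_le)

lemma mult_pos_iff:
  fixes a b :: "'k::{division_ring,linordered_ring}"
  assumes "0 < a"
  shows "0 < a * b \<longleftrightarrow> 0 < b"
proof (cases b "0::'k" rule: linorder_cases)
  case less
  then have "0 < a * (- b)" using assms by (intro mult_pos) simp_all
  then have "a * b < 0" by simp
  then show ?thesis using less by (meson less_asym)
qed (use assms mult_pos in auto)

lemma inverse_pos:
  fixes a :: "'k::{division_ring,linordered_ring}"
  assumes "0 < a"
  shows "0 < inverse a"
  using mult_pos_iff[OF assms, of "inverse a"] assms one_pos[where 'k = 'k] by simp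

section \<open>Choosing a cut over a countable set\<close>

text \<open>
  The largest values \<open>U\<close>, \<open>V\<close> allowed by the upper bounds on \<open>u'\<close>, \<open>v'\<close> satisfy all conditions but
  disjointness; complete normality makes them disjoint without losing the lower bounds.
\<close>

lemma cut_step:
  fixes h :: "'v::ab_group_add \<Rightarrow> 'l::completely_normal_lattice" and c :: "nat \<Rightarrow> 'v"
  assumes h: "\<And>a b d P. \<lbrakk>a \<in> C; b \<in> C; d \<in> C; prime_filter P; h (a - b) \<in> P\<rbrakk> \<Longrightarrow> h (a - d) \<in> P \<or> h (d - b) \<in> P"
    and h0: "\<And>a b P. \<lbrakk>a \<in> C; b \<in> C; prime_filter P; h (a - b) \<in> P\<rbrakk> \<Longrightarrow> h (b - a) \<notin> P"
    and c: "\<And>i. i \<le> n \<Longrightarrow> c i \<in> C" and x: "x \<in> C"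
    and disj: "\<And>i. i \<le> n \<Longrightarrow> inf (u i) (v i) = bot"
    and u: "\<And>i j. \<lbrakk>i \<le> n; j \<le> n\<rbrakk> \<Longrightarrow> u i \<le> sup (h (c j - c i)) (u j)"
    and v: "\<And>i j. \<lbrakk>i \<le> n; j \<le> n\<rbrakk> \<Longrightarrow> v i \<le> sup (h (c i - c j)) (v j)"
    and uv: "\<And>i j. \<lbrakk>i \<le> n; j \<le> n\<rbrakk> \<Longrightarrow> h (c j - c i) \<le> sup (u i) (v j)"
  shows "\<exists>u' v'. inf u' v' = bot \<and> (\<forall>i\<le>n.
      u' \<le> sup (h (c i - x)) (u i) \<and> u i \<le> sup (h (x - c i)) u' \<and>
      v' \<le> sup (h (x - c i)) (v i) \<and> v i \<le> sup (h (c i - x)) v' \<and>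
      h (c i - x) \<le> sup u' (v i) \<and> h (x - c i) \<le> sup (u i) v')"
proof -
  obtain U where "\<And>P. prime_filter P \<Longrightarrow> U \<in> P \<longleftrightarrow> (\<forall>e\<le>n. sup (h (c e - x)) (u e) \<in> P)"
    using finite_meet_prime_filter[of n "\<lambda>e. sup (h (c e - x)) (u e)"] by blast
  then have U: "\<And>P. prime_filter P \<Longrightarrow> U \<in> P \<longleftrightarrow> (\<forall>e\<le>n. h (c e - x) \<in> P \<or> u e \<in> P)"
    by (simp add: prime_filterD)
  obtain V where "\<And>P. prime_filter P \<Longrightarrow> V \<in> P \<longleftrightarrow> (\<forall>e\<le>n. sup (h (x - c e)) (v e) \<in> P)"
    using finite_meet_prime_filter[of n "\<lambda>e. sup (h (x - c e)) (v e)"] by blast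
  then have V: "\<And>P. prime_filter P \<Longrightarrow> V \<in> P \<longleftrightarrow> (\<forall>e\<le>n. h (x - c e) \<in> P \<or> v e \<in> P)"
    by (simp add: prime_filterD)
  \<comment> \<open>The equations say that outside \<open>V\<close> the elements \<open>u0\<close>
    and \<open>U\<close> have the same prime filters, and outside \<open>U\<close> so do
    \<open>v0\<close> and \<open>V\<close>. Meeting \<open>u0\<close> with \<open>U\<close> and
    \<open>v0\<close> with \<open>V\<close> restores the upper bounds.\<close>
  obtain u0 v0 where uv0: "sup U V = sup U v0" "sup U V = sup u0 V" "inf u0 v0 = bot"
    using completely_normal[of U V] by blast
  define u' where "u' = inf u0 U"
  define v' where "v' = inf v0 V"
  \<comment> \<open>At a fixed prime filter every requirement is a propositional statement about
    memberships.\<close>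
  have loc: "\<not> (u' \<in> P \<and> v' \<in> P) \<and>
      (u' \<in> P \<longrightarrow> h (c i - x) \<in> P \<or> u i \<in> P) \<and> (u i \<in> P \<longrightarrow> h (x - c i) \<in> P \<or> u' \<in> P) \<and>
      (v' \<in> P \<longrightarrow> h (x - c i) \<in> P \<or> v i \<in> P) \<and> (v i \<in> P \<longrightarrow> h (c i - x) \<in> P \<or> v' \<in> P) \<and>
      (h (c i - x) \<in> P \<longrightarrow> u' \<in> P \<or> v i \<in> P) \<and> (h (x - c i) \<in> P \<longrightarrow> u i \<in> P \<or> v' \<in> P)"
    if P: "prime_filter P" and i: "i \<le> n" for P i
  proof -
    note D = prime_filterD[OF P]
    have 1: "u0 \<notin> P \<or> v0 \<notin> P" "U \<in> P \<or> V \<in> P \<longleftrightarrow> U \<in> P \<or> v0 \<in> P" "U \<in> P \<or> V \<in> P \<longleftrightarrow> u0 \<in> P \<or> V \<in> P"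
      using uv0 D(3) D(2)[of u0 v0] D(1)[of U V] D(1)[of U v0] D(1)[of u0 V] by simp_all
    have 2: "u' \<in> P \<longleftrightarrow> u0 \<in> P \<and> U \<in> P" "v' \<in> P \<longleftrightarrow> v0 \<in> P \<and> V \<in> P"
      by (simp_all add: u'_def v'_def D)
    have 3: "\<not> (u j \<in> P \<and> v j \<in> P)" if "j \<le> n" for j
      using disj[OF that] D(3) by (simp flip: D(2))
    have 4: "u j \<in> P \<Longrightarrow> h (c k - c j) \<in> P \<or> u k \<in> P" "v j \<in> P \<Longrightarrow> h (c j - c k) \<in> P \<or> v k \<in> P"
      "h (c k - c j) \<in> P \<Longrightarrow> u j \<in> P \<or> v k \<in> P" if "j \<le> n" "k \<le> n" for j k
      using u[OF that] v[OF that] uv[OF that] prime_filter_mono[OF P] by (simp_all flip: D(1))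
    have hx: "\<not> (h (c i - x) \<in> P \<and> h (x - c i) \<in> P)"
      using h0[OF c[OF i] x P] by blast
    \<comment> \<open>Facts 5 to 8 are the lower bounds for \<open>U\<close> and \<open>V\<close> in
      place of \<open>u'\<close> and \<open>v'\<close>. Each is verified against every factor of the
      finite meet, using the triangle inequality for \<open>h\<close>.\<close>
    have 5: "h (c i - x) \<in> P \<Longrightarrow> U \<in> P \<or> v i \<in> P"
    proof -
      assume a: "h (c i - x) \<in> P"
      have "h (c e - x) \<in> P \<or> u e \<in> P \<or> v i \<in> P" if e: "e \<le> n" for e
        using h[OF c[OF i] x c[OF e] P a] 4(3)[OF e i] by blast
      then show ?thesis using U[OF P] by blast
    qed
    have 6: "h (x - c i) \<in> P \<Longrightarrow> V \<in> P \<or> u i \<in> P"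
    proof -
      assume a: "h (x - c i) \<in> P"
      have "h (x - c e) \<in> P \<or> v e \<in> P \<or> u i \<in> P" if e: "e \<le> n" for e
        using h[OF x c[OF i] c[OF e] P a] 4(3)[OF i e] by blast
      then show ?thesis using V[OF P] by blast
    qed
    have 7: "u i \<in> P \<Longrightarrow> h (x - c i) \<in> P \<or> U \<in> P"
    proof -
      assume a: "u i \<in> P"
      have "h (c e - x) \<in> P \<or> u e \<in> P \<or> h (x - c i) \<in> P" if e: "e \<le> n" for e
        using h[OF c[OF e] c[OF i] x P] 4(1)[OF i e a] by blast
      then show ?thesis using U[OF P] by blast
    qed
    have 8: "v i \<in> P \<Longrightarrow> h (c i - x) \<in> P \<or> V \<in> P"
    proof -
      assume a: "v i \<in> P"
      have "h (x - c e) \<in> P \<or> v e \<in> P \<or> h (c i - x) \<in> P" if e: "e \<le> n" for e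
        using h[OF c[OF i] c[OF e] x P] 4(2)[OF i e a] by blast
      then show ?thesis using V[OF P] by blast
    qed
    have 9: "U \<in> P \<Longrightarrow> h (c i - x) \<in> P \<or> u i \<in> P" "V \<in> P \<Longrightarrow> h (x - c i) \<in> P \<or> v i \<in> P"
      using U[OF P] V[OF P] i by blast+
    \<comment> \<open>Where \<open>V\<close> fails, \<open>u'\<close> agrees with \<open>U\<close>
      and the lower bounds for \<open>U\<close> apply. Where \<open>V\<close> holds, its upper bound
      gives \<open>h (x - c i)\<close> or \<open>v i\<close>; by \<open>hx\<close> and fact 3 this
      either settles the claim or contradicts its premise. The argument for \<open>v'\<close> is
      symmetric.\<close>
    show ?thesis
      unfolding 2 using 1 3[OF i] hx 5 6 7 8 9 by argo
  qed
  have le: "a \<le> sup b d" if "\<And>P. prime_filter P \<Longrightarrow> a \<in> P \<Longrightarrow> b \<in> P \<or> d \<in> P" for a b d :: 'l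
    using that by (simp add: le_iff_prime_filter prime_filterD)
  have "inf u' v' \<le> bot"
    using loc[of _ 0] by (simp add: le_iff_prime_filter prime_filterD)
  then have "inf u' v' = bot" by (simp add: bot_unique)
  moreover have "u' \<le> sup (h (c i - x)) (u i)" "u i \<le> sup (h (x - c i)) u'"
    "v' \<le> sup (h (x - c i)) (v i)" "v i \<le> sup (h (c i - x)) v'"
    "h (c i - x) \<le> sup u' (v i)" "h (x - c i) \<le> sup (u i) v'" if i: "i \<le> n" for i
    by (rule le; use loc[OF _ i] in simp)+
  ultimately show ?thesis by blast
qed

text \<open>Countability is what makes the choice possible: a new pair has to fit only finitely many
  earlier ones, so the finite meets in \<open>cut_step\<close> suffice. The first pair meets no
  earlier constraint and may be taken to be \<open>(l, bot)\<close>.\<close>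

lemma cut_sequence:
  fixes h :: "'v::ab_group_add \<Rightarrow> 'l::completely_normal_lattice" and c :: "nat \<Rightarrow> 'v"
  assumes h: "\<And>a b d P. \<lbrakk>a \<in> C; b \<in> C; d \<in> C; prime_filter P; h (a - b) \<in> P\<rbrakk> \<Longrightarrow> h (a - d) \<in> P \<or> h (d - b) \<in> P"
    and h0: "\<And>a b P. \<lbrakk>a \<in> C; b \<in> C; prime_filter P; h (a - b) \<in> P\<rbrakk> \<Longrightarrow> h (b - a) \<notin> P"
    and c: "\<And>i. c i \<in> C"
  obtains u v where "u 0 = l" "v 0 = bot" "\<And>i. inf (u i) (v i) = bot"
    "\<And>i j. u i \<le> sup (h (c j - c i)) (u j)" "\<And>i j. v i \<le> sup (h (c i - c j)) (v j)"
    "\<And>i j. h (c j - c i) \<le> sup (u i) (v j)"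
proof -
  define G where "G n F \<longleftrightarrow> F 0 = (l, bot) \<and> (\<forall>i\<le>n. inf (fst (F i)) (snd (F i)) = bot) \<and>
    (\<forall>i\<le>n. \<forall>j\<le>n. fst (F i) \<le> sup (h (c j - c i)) (fst (F j)) \<and>
      snd (F i) \<le> sup (h (c i - c j)) (snd (F j)) \<and>
      h (c j - c i) \<le> sup (fst (F i)) (snd (F j)))" for n and F :: "nat \<Rightarrow> 'l \<times> 'l"
  \<comment> \<open>By \<open>h0\<close> with \<open>a = b\<close>, the element \<open>h 0\<close>
    lies in no prime filter. This settles every constraint between an index and itself.\<close>
  have h00: "h 0 \<le> b" for b
    using h0[OF c[of 0] c[of 0]] by (auto simp: le_iff_prime_filter)
  have "\<exists>F. G 0 F"
    by (rule exI[of _ "\<lambda>_. (l, bot)"]) (simp add: G_def h00)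
  moreover have "\<exists>F'. G (Suc n) F' \<and> (\<forall>i\<le>n. F' i = F i)" if F: "G n F" for n F
  proof -
    have "\<exists>u' v'. inf u' v' = bot \<and> (\<forall>i\<le>n.
        u' \<le> sup (h (c i - c (Suc n))) (fst (F i)) \<and> fst (F i) \<le> sup (h (c (Suc n) - c i)) u' \<and>
        v' \<le> sup (h (c (Suc n) - c i)) (snd (F i)) \<and> snd (F i) \<le> sup (h (c i - c (Suc n))) v' \<and>
        h (c i - c (Suc n)) \<le> sup u' (snd (F i)) \<and> h (c (Suc n) - c i) \<le> sup (fst (F i)) v')"
    proof (rule cut_step[where C = C])
      show "h (a - d) \<in> P \<or> h (d - b) \<in> P"
        if "a \<in> C" "b \<in> C" "d \<in> C" "prime_filter P" "h (a - b) \<in> P" for a b d P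
        using that by (rule h)
      show "h (b - a) \<notin> P" if "a \<in> C" "b \<in> C" "prime_filter P" "h (a - b) \<in> P" for a b P
        using that by (rule h0)
    qed (use F c in \<open>simp_all add: G_def\<close>)
    then obtain u' v' where uv: "inf u' v' = bot" "\<And>i. i \<le> n \<Longrightarrow>
        u' \<le> sup (h (c i - c (Suc n))) (fst (F i)) \<and> fst (F i) \<le> sup (h (c (Suc n) - c i)) u' \<and>
        v' \<le> sup (h (c (Suc n) - c i)) (snd (F i)) \<and> snd (F i) \<le> sup (h (c i - c (Suc n))) v' \<and>
        h (c i - c (Suc n)) \<le> sup u' (snd (F i)) \<and> h (c (Suc n) - c i) \<le> sup (fst (F i)) v'"
      by blast
    show ?thesis
      by (rule exI[of _ "F(Suc n := (u', v'))"])
        (use F uv h00 in \<open>auto simp: G_def le_Suc_eq\<close>)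
  qed
  ultimately obtain F where F: "\<And>n. G n (F n)" and ext: "\<And>n i. i \<le> n \<Longrightarrow> F (Suc n) i = F n i"
    using dependent_nat_choice[of G "\<lambda>n F F'. \<forall>i\<le>n. F' i = F i"] by metis
  \<comment> \<open>A pair is never changed once chosen, so the diagonal defines the limit; a
    constraint on \<open>i\<close> and \<open>j\<close> is read off at stage
    \<open>max i j\<close>.\<close>
  have FF: "F n i = F i i" if "i \<le> n" for n i
    using that by (induction n rule: dec_induct) (simp_all add: ext)
  define u where "u i = fst (F i i)" for i
  define v where "v i = snd (F i i)" for i
  have "u i \<le> sup (h (c j - c i)) (u j) \<and> v i \<le> sup (h (c i - c j)) (v j) \<and>
      h (c j - c i) \<le> sup (u i) (v j)" for i j
    using F[of "max i j"] FF[of i "max i j"] FF[of j "max i j"]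
    unfolding G_def u_def v_def by (metis max.cobounded1 max.cobounded2)
  moreover have "inf (u i) (v i) = bot" for i
    using F[of i] by (simp add: G_def u_def v_def)
  moreover have "u 0 = l" "v 0 = bot"
    using F[of 0] by (simp_all add: G_def u_def v_def)
  ultimately show thesis using that by blast
qed

section \<open>Left vector spaces and their valuations\<close>

locale left_vector_space =
  fixes scale :: "'k::{division_ring,linordered_ring} \<Rightarrow> 'v::ab_group_add \<Rightarrow> 'v"
  assumes scale_add: "scale a (x + y) = scale a x + scale a y"
    and add_scale: "scale (a + b) x = scale a x + scale b x"
    and mult_scale: "scale (a * b) x = scale a (scale b x)"
    and one_scale: "scale 1 x = x"
begin

lemma scale_zero [simp]: "scale a 0 = 0"
  using scale_add[of a 0 0] by simp

lemma zero_scale [simp]: "scale 0 x = 0"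
  using add_scale[of 0 0 x] by simp

lemma scale_minus: "scale a (- x) = - scale a x"
  using scale_add[of a x "- x"] by (simp add: eq_neg_iff_add_eq_0 add.commute)

lemma minus_scale: "scale (- a) x = - scale a x"
  using add_scale[of a "- a" x] by (simp add: eq_neg_iff_add_eq_0 add.commute)

lemma scale_diff: "scale a (x - y) = scale a x - scale a y"
  using scale_add[of a x "- y"] by (simp add: scale_minus)

definition subspace :: "'v set \<Rightarrow> bool" where
  "subspace W \<longleftrightarrow> 0 \<in> W \<and> (\<forall>x\<in>W. \<forall>y\<in>W. x + y \<in> W) \<and> (\<forall>a. \<forall>x\<in>W. scale a x \<in> W)"

lemma subspaceD:
  assumes "subspace W"
  shows "0 \<in> W" "x \<in> W \<Longrightarrow> y \<in> W \<Longrightarrow> x + y \<in> W" "x \<in> W \<Longrightarrow> scale a x \<in> W"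
    "x \<in> W \<Longrightarrow> - x \<in> W" "x \<in> W \<Longrightarrow> y \<in> W \<Longrightarrow> x - y \<in> W"
proof -
  show 1: "0 \<in> W" "x \<in> W \<Longrightarrow> scale a x \<in> W" and 2: "x \<in> W \<Longrightarrow> y \<in> W \<Longrightarrow> x + y \<in> W" for x y a
    using assms by (auto simp: subspace_def)
  show 3: "x \<in> W \<Longrightarrow> - x \<in> W" for x
    using 1(2)[of x "- 1"] by (simp add: minus_scale one_scale)
  show "x \<in> W \<Longrightarrow> y \<in> W \<Longrightarrow> x - y \<in> W"
    using 2[of x "- y"] 3 by simp
qed

text \<open>\<open>h a\<close> plays the role of the set of points at which \<open>a\<close> is positive.\<close>

definition valuation :: "'v set \<Rightarrow> ('v \<Rightarrow> 'l::{distrib_lattice,bounded_lattice_bot}) \<Rightarrow> bool" where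
  "valuation W h \<longleftrightarrow>
    (\<forall>a\<in>W. inf (h a) (h (- a)) = bot) \<and>
    (\<forall>a\<in>W. \<forall>b\<in>W. h (a + b) \<le> sup (h a) (h b)) \<and>
    (\<forall>k>0. \<forall>a\<in>W. h (scale k a) = h a)"

text \<open>Seen at \<open>P\<close>, a valuation is a total preorder compatible with the vector
  space structure, with \<open>a\<close> strictly above \<open>b\<close> when
  \<open>h (a - b) \<in> P\<close>. These are the rules for its strictly positive elements.\<close>

lemma valuation_prime_filter:
  assumes "valuation W h" "prime_filter P"
  shows "a \<in> W \<Longrightarrow> h a \<in> P \<Longrightarrow> h (- a) \<in> P \<Longrightarrow> False"
    and "a \<in> W \<Longrightarrow> b \<in> W \<Longrightarrow> h (a + b) \<in> P \<Longrightarrow> h a \<in> P \<or> h b \<in> P"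
    and "k > 0 \<Longrightarrow> a \<in> W \<Longrightarrow> h (scale k a) \<in> P \<longleftrightarrow> h a \<in> P"
proof -
  show "False" if "a \<in> W" "h a \<in> P" "h (- a) \<in> P"
    using that assms prime_filterD(2)[OF assms(2), of "h a" "h (- a)"] prime_filterD(3)[OF assms(2)]
    by (simp add: valuation_def)
  show "h a \<in> P \<or> h b \<in> P" if "a \<in> W" "b \<in> W" "h (a + b) \<in> P"
    using that assms prime_filterD(1)[OF assms(2), of "h a" "h b"]
      prime_filter_mono[OF assms(2), of "h (a + b)" "sup (h a) (h b)"]
    by (simp add: valuation_def)
  show "h (scale k a) \<in> P \<longleftrightarrow> h a \<in> P" if "k > 0" "a \<in> W"
    using assms(1) that unfolding valuation_def by metis
qed

lemma valuation_prime_filter_zero: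
  assumes "valuation W h" "prime_filter P" "0 \<in> W"
  shows "h 0 \<notin> P"
  using valuation_prime_filter(1)[OF assms] by auto

lemma scale_cancel:
  assumes "a \<noteq> 0" "scale a x = scale a y"
  shows "x = y"
proof -
  have "scale (inverse a * a) x = scale (inverse a * a) y"
    using assms(2) by (simp only: mult_scale)
  then show ?thesis using assms(1) by (simp add: one_scale)
qed

lemma valuation_proportional:
  assumes "valuation W h" "a \<in> W" "b \<in> W" "0 < k" "0 < l" "scale k a = scale l b"
  shows "h a = h b"
  using assms unfolding valuation_def by metis

text \<open>A vector \<open>w\<close> of \<open>W'\<close> with \<open>\<kappa> w \<noteq> 0\<close>
  equals \<open>scale (\<kappa> w) (x - p w)\<close> with \<open>p w\<close> in \<open>W\<close>.
  Its positivity therefore says \<open>x > p w\<close> or \<open>x < p w\<close>, according to the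
  sign of \<open>\<kappa> w\<close>, and the cut \<open>(u, v)\<close> supplies the value.
  Subadditivity is checked at each prime filter by the signs of the coefficients.\<close>

lemma valuation_extend:
  fixes h :: "'v \<Rightarrow> 'l::completely_normal_lattice" and \<kappa> :: "'v \<Rightarrow> 'k"
  assumes h: "valuation W h" and W: "subspace W" "countable W"
    and W': "W' = {scale a x + c | a c. c \<in> W}"
    and \<kappa>_add: "\<And>y z. \<kappa> (y + z) = \<kappa> y + \<kappa> z" and \<kappa>_scale: "\<And>a y. \<kappa> (scale a y) = a * \<kappa> y"
    and \<kappa>_x: "\<kappa> x = 1" and \<kappa>_W: "\<And>y. y \<in> W \<Longrightarrow> \<kappa> y = 0"
  obtains h' where "valuation W' h'" "\<And>y. y \<in> W \<Longrightarrow> h' y = h y" "h' x = l" "h' (- x) = bot"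
proof -
  note S = subspaceD[OF W(1)]
  \<comment> \<open>Index 0 is reserved for the vector 0, so that the prescribed pair
    \<open>(l, bot)\<close> belongs to the comparison of \<open>x\<close> with 0. The vector 0
    occurs again later in the enumeration.\<close>
  define c where "c = case_nat 0 (from_nat_into W)"
  have c: "c i \<in> W" for i
    using S(1) from_nat_into[of W] by (auto simp: c_def split: nat.split)
  have c_surj: "\<exists>i. c i = y" if "y \<in> W" for y
  proof -
    obtain n where n: "from_nat_into W n = y"
      using from_nat_into_surj[OF W(2) \<open>y \<in> W\<close>] by blast
    have "c (Suc n) = y" using n by (simp add: c_def)
    then show ?thesis by blast
  qed
  have tri: "h (a - d) \<in> P \<or> h (d - b) \<in> P"
    if "a \<in> W" "b \<in> W" "d \<in> W" "prime_filter P" "h (a - b) \<in> P" for a b d P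
    using valuation_prime_filter(2)[OF h that(4), of "a - d" "d - b"] S(5) that by simp
  have anti: "h (b - a) \<notin> P" if "a \<in> W" "b \<in> W" "prime_filter P" "h (a - b) \<in> P" for a b P
    using valuation_prime_filter(1)[OF h that(3), of "a - b"] S(5) that by auto
  obtain u0 v0 where u0: "u0 0 = l" "v0 0 = bot" and uv0: "\<And>i. inf (u0 i) (v0 i) = bot"
    "\<And>i j. u0 i \<le> sup (h (c j - c i)) (u0 j)" "\<And>i j. v0 i \<le> sup (h (c i - c j)) (v0 j)"
    "\<And>i j. h (c j - c i) \<le> sup (u0 i) (v0 j)"
  proof (rule cut_sequence[where C = W and h = h and c = c and l = l])
    show "h (a - d) \<in> P \<or> h (d - b) \<in> P"
      if "a \<in> W" "b \<in> W" "d \<in> W" "prime_filter P" "h (a - b) \<in> P" for a b d P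
      using that by (rule tri)
    show "h (b - a) \<notin> P" if "a \<in> W" "b \<in> W" "prime_filter P" "h (a - b) \<in> P" for a b P
      using that by (rule anti)
    show "c i \<in> W" for i by (rule c)
  qed (rule that)
  \<comment> \<open>The enumeration has repetitions; taking the least index makes the cut a function
    of the vector and sends 0 to the reserved index.\<close>
  define idx where "idx y = (LEAST i. c i = y)" for y
  have idx: "c (idx y) = y" if "y \<in> W" for y
    unfolding idx_def using c_surj[OF that] by (rule LeastI_ex)
  have idx0: "idx 0 = 0"
    unfolding idx_def by (rule Least_equality) (simp_all add: c_def)
  define u where "u y = u0 (idx y)" for y
  define v where "v y = v0 (idx y)" for y
  have disj: "inf (u a) (v a) = bot" for a
    by (simp add: u_def v_def uv0)
  have cut: "u a \<le> sup (h (b - a)) (u b)" "v a \<le> sup (h (a - b)) (v b)" "h (b - a) \<le> sup (u a) (v b)"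
    if "a \<in> W" "b \<in> W" for a b
    using uv0(2)[of "idx a" "idx b"] uv0(3)[of "idx a" "idx b"] uv0(4)[of "idx b" "idx a"] idx that
    by (simp_all add: u_def v_def)
  \<comment> \<open>This is the point of \<open>W\<close> at which \<open>w\<close> changes sign as
    \<open>x\<close> varies: formally, the solution for \<open>x\<close> of
    \<open>w = 0\<close>.\<close>
  define p where "p w = x - scale (inverse (\<kappa> w)) w" for w
  have \<kappa>_minus: "\<kappa> (- w) = - \<kappa> w" for w
    using \<kappa>_scale[of "- 1" w] by (simp add: minus_scale one_scale)
  have p: "scale (\<kappa> w) (p w) = scale (\<kappa> w) x - w" if "\<kappa> w \<noteq> 0" for w
    using that by (simp add: p_def scale_diff flip: mult_scale) (simp add: one_scale)
  have p_W: "p w \<in> W" if w: "w \<in> W'" "\<kappa> w \<noteq> 0" for w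
  proof -
    obtain a d where ad: "w = scale a x + d" "d \<in> W"
      using w W' by blast
    then have "\<kappa> w = a" by (simp add: \<kappa>_add \<kappa>_scale \<kappa>_x \<kappa>_W)
    then have "p w = - scale (inverse a) d"
      using w(2) by (simp add: p_def ad(1) scale_add flip: mult_scale) (simp add: one_scale)
    then show ?thesis using S ad(2) by simp
  qed
  have W'_W: "w \<in> W" if w: "w \<in> W'" "\<kappa> w = 0" for w
  proof -
    obtain a d where ad: "w = scale a x + d" "d \<in> W"
      using w W' by blast
    then have "\<kappa> w = a" by (simp add: \<kappa>_add \<kappa>_scale \<kappa>_x \<kappa>_W)
    then show ?thesis using ad w(2) by simp
  qed
  have W_W': "w \<in> W'" if "w \<in> W" for w
    unfolding W' using that by (intro CollectI exI[of _ 0] exI[of _ w]) simp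
  have W'_add: "w + z \<in> W'" if wz: "w \<in> W'" "z \<in> W'" for w z
  proof -
    obtain a d b e where "w = scale a x + d" "d \<in> W" "z = scale b x + e" "e \<in> W"
      using wz W' by blast
    then show ?thesis
      unfolding W' using S(2)
      by (intro CollectI exI[of _ "a + b"] exI[of _ "d + e"]) (simp add: add_scale algebra_simps)
  qed
  have W'_scale: "scale b w \<in> W'" if w: "w \<in> W'" for w b
  proof -
    obtain a d where "w = scale a x + d" "d \<in> W"
      using w W' by blast
    then show ?thesis
      unfolding W' using S(3)
      by (intro CollectI exI[of _ "b * a"] exI[of _ "scale b d"]) (simp add: mult_scale scale_add)
  qed
  have p_scale: "p (scale b w) = p w" if "b \<noteq> 0" "\<kappa> w \<noteq> 0" for b w
  proof (rule scale_cancel)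
    show "b * \<kappa> w \<noteq> 0" using that by simp
    have "scale (b * \<kappa> w) (p (scale b w)) = scale (b * \<kappa> w) x - scale b w"
      using p[of "scale b w"] that by (simp add: \<kappa>_scale)
    then show "scale (b * \<kappa> w) (p (scale b w)) = scale (b * \<kappa> w) (p w)"
      using p[OF that(2)] by (simp add: mult_scale scale_diff)
  qed
  define h' where "h' w = (if \<kappa> w = 0 then h w else if 0 < \<kappa> w then u (p w) else v (p w))" for w
  have h'_W: "h' w = h w" if "w \<in> W" for w
    using \<kappa>_W[OF that] by (simp add: h'_def)
  have \<kappa>_sgn: "0 < k * \<kappa> w \<longleftrightarrow> 0 < \<kappa> w" if "0 < k" for k w
    using mult_pos_iff[OF that] .
  have hom: "h' (scale k w) = h' w" if k: "0 < k" and w: "w \<in> W'" for k w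
  proof (cases "\<kappa> w = 0")
    case True
    then have "h (scale k w) = h w"
      using W'_W[OF w] h k by (simp add: valuation_def)
    then show ?thesis using True by (simp add: h'_def \<kappa>_scale)
  next
    case False
    then show ?thesis using k less_imp_neq[OF k] p_scale[of k w] by (simp add: h'_def \<kappa>_scale \<kappa>_sgn)
  qed
  have opp: "inf (h' w) (h' (- w)) = bot" if w: "w \<in> W'" for w
  proof (cases "\<kappa> w = 0")
    case True
    then show ?thesis using W'_W[OF w] h by (simp add: h'_def \<kappa>_minus valuation_def)
  next
    case False
    have "p (- w) = p w"
      using p_scale[of "- 1" w] False by (simp add: minus_scale one_scale)
    then show ?thesis
      using False disj[of "p w"] less_asym[of 0 "\<kappa> w"]
      by (auto simp: h'_def \<kappa>_minus inf_commute not_less_iff_gr_or_eq)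
  qed
  have sub: "h' (w + z) \<le> sup (h' w) (h' z)" if w: "w \<in> W'" and z: "z \<in> W'" for w z
    unfolding le_iff_prime_filter
  proof (intro allI impI)
    fix P :: "'l set"
    assume P: "prime_filter P" and wz: "h' (w + z) \<in> P"
    note val = valuation_prime_filter[OF h P]
    have cutP: "u a \<in> P \<Longrightarrow> h (b - a) \<in> P \<or> u b \<in> P" "v a \<in> P \<Longrightarrow> h (a - b) \<in> P \<or> v b \<in> P"
      "h (b - a) \<in> P \<Longrightarrow> u a \<in> P \<or> v b \<in> P"
      if "a \<in> W" "b \<in> W" for a b
      using cut[OF that] prime_filter_mono[OF P] by (simp_all flip: prime_filterD(1)[OF P])
    have proportional: "h a = h b" if "a \<in> W" "b \<in> W" "0 < k" "0 < l" "scale k a = scale l b" for a b k l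
      using h that by (rule valuation_proportional)
    have neg_prop: "\<not> (h a \<in> P \<and> h b \<in> P)"
      if "a \<in> W" "b \<in> W" "0 < k" "0 < l" "scale k a = - scale l b" for a b k l
      using proportional[of a "- b" k l] that val(1)[of b] S(4) by (auto simp: scale_minus)
    \<comment> \<open>The point \<open>p (w + z)\<close> is the mean of \<open>p w\<close> and
      \<open>p z\<close> with weights \<open>\<kappa> w\<close> and \<open>\<kappa> z\<close>. All
      comparisons between the three points below come from this identity.\<close>
    have p_add: "scale (\<kappa> w) (p (w + z)) + scale (\<kappa> z) (p (w + z)) =
        scale (\<kappa> w) (p w) + scale (\<kappa> z) (p z)"
      if "\<kappa> w \<noteq> 0" "\<kappa> z \<noteq> 0" "\<kappa> w + \<kappa> z \<noteq> 0" for w z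
    proof -
      have "scale (\<kappa> w) (p (w + z)) + scale (\<kappa> z) (p (w + z)) = scale (\<kappa> (w + z)) (p (w + z))"
        by (simp add: \<kappa>_add add_scale)
      also have "\<dots> = scale (\<kappa> w) x + scale (\<kappa> z) x - (w + z)"
        using that by (subst p) (simp_all add: \<kappa>_add add_scale)
      also have "\<dots> = scale (\<kappa> w) (p w) + scale (\<kappa> z) (p z)"
        using that by (simp add: p)
      finally show ?thesis .
    qed
    have pos_case: "h' w \<in> P \<or> h' z \<in> P"
      if w: "w \<in> W'" and z: "z \<in> W'" and wz: "h' (w + z) \<in> P"
        and less: "0 < \<kappa> w" for w z
    proof -
      let ?k = "\<kappa> w" and ?l = "\<kappa> z"
      have wz_W: "w + z \<in> W'" using W'_add w z by blast
      have pw: "p w \<in> W" "scale ?k (p w) = scale ?k x - w"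
        using p_W w less p by auto
      consider "?l = 0" | "0 < ?l" | "?l < 0" by fastforce
      then show ?thesis
      proof cases
        \<comment> \<open>Here \<open>p w - p (w + z)\<close> is a positive multiple of
          \<open>z\<close>. So from \<open>x > p (w + z)\<close> at \<open>P\<close>, either
          \<open>z\<close> is positive or \<open>x > p w\<close>.\<close>
        case 1
        then have q: "p (w + z) \<in> W" "scale ?k (p (w + z)) = scale ?k x - (w + z)"
          using p_W[OF wz_W] p[of "w + z"] less by (auto simp: \<kappa>_add)
        have "scale ?k (p w - p (w + z)) = scale 1 z"
          by (simp add: scale_diff one_scale pw q)
        then have "h (p w - p (w + z)) = h z"
          using proportional[of "p w - p (w + z)" z ?k 1] W'_W[OF z] S(5) pw q 1 less one_pos by blast
        moreover have "u (p (w + z)) \<in> P" using wz 1 less by (auto simp: h'_def \<kappa>_add split: if_splits)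
        ultimately show ?thesis
          using cutP(1)[OF q(1) pw(1)] 1 less by (auto simp: h'_def)
      next
        \<comment> \<open>With positive weights the mean cannot lie strictly below both points, so
          \<open>x > p (w + z)\<close> forces \<open>x > p w\<close> or \<open>x > p z\<close> at
          \<open>P\<close>.\<close>
        case 2
        then have pos: "0 < ?k + ?l" using less by (simp add: add_pos_pos)
        then have q: "p (w + z) \<in> W" "scale (?k + ?l) (p (w + z)) = scale (?k + ?l) x - (w + z)"
          using p_W[OF wz_W] p[of "w + z"] by (auto simp: \<kappa>_add)
        have pz: "p z \<in> W" "scale ?l (p z) = scale ?l x - z"
          using p_W z 2 p by auto
        have "scale ?k (p w - p (w + z)) = - scale ?l (p z - p (w + z))"
          using p_add[of w z] 2 less pos by (simp add: scale_diff algebra_simps)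
        then have "\<not> (h (p w - p (w + z)) \<in> P \<and> h (p z - p (w + z)) \<in> P)"
          using neg_prop S(5) pw pz q 2 less by blast
        moreover have "u (p (w + z)) \<in> P" using wz pos by (auto simp: h'_def \<kappa>_add split: if_splits)
        ultimately show ?thesis
          using cutP(1)[OF q(1) pw(1)] cutP(1)[OF q(1) pz(1)] 2 less by (auto simp: h'_def)
      next
        \<comment> \<open>Now \<open>w\<close> asks for \<open>x > p w\<close> and \<open>z\<close>
          for \<open>x < p z\<close>, so \<open>p z > p w\<close> at \<open>P\<close> is enough. If
          \<open>w + z\<close> lies in \<open>W\<close>, it is a positive multiple of
          \<open>p z - p w\<close>. If the sum of the coefficients is positive, \<open>p w\<close>
          lies between \<open>p (w + z)\<close> and \<open>p z\<close>; if it is negative,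
          \<open>p z\<close> lies between \<open>p w\<close> and \<open>p (w + z)\<close>. In both
          cases moving along the cut from \<open>p (w + z)\<close> to the middle point
          suffices.\<close>
        case 3
        have pz: "p z \<in> W" "scale ?l (p z) = scale ?l x - z"
          using p_W z 3 p by auto
        have concl: "h' w \<in> P \<or> h' z \<in> P" if "h (p z - p w) \<in> P"
          using cutP(3)[OF pw(1) pz(1) that] 3 less by (auto simp: h'_def)
        show ?thesis
        proof (cases "?k + ?l" "0::'k" rule: linorder_cases)
          case equal
          have l: "?l = - ?k" using equal by (simp add: eq_neg_iff_add_eq_0 add.commute)
          have "- scale ?k (p z) = - (scale ?k x + z)"
            using pz(2) by (simp add: l minus_scale)
          then have pz': "scale ?k (p z) = scale ?k x + z"
            by (simp only: neg_equal_iff_equal)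
          have "scale ?k (p z - p w) = scale 1 (w + z)"
            by (simp add: scale_diff one_scale pw(2) pz')
          then have "h (p z - p w) = h (w + z)"
            using proportional[of "p z - p w" "w + z" ?k 1] W'_W[OF wz_W] S(5) pw pz equal less one_pos
            by (simp add: \<kappa>_add)
          then show ?thesis using wz equal concl by (auto simp: h'_def \<kappa>_add split: if_splits)
        next
          case greater
          then have q: "p (w + z) \<in> W" "scale (?k + ?l) (p (w + z)) = scale (?k + ?l) x - (w + z)"
            using p_W[OF wz_W] p[of "w + z"] by (auto simp: \<kappa>_add)
          have "scale (- ?l) (p z - p w) = scale (?k + ?l) (p w - p (w + z))"
            using p_add[of w z] 3 less greater
            by (simp add: scale_diff add_scale minus_scale algebra_simps)
          then have eq: "h (p z - p w) = h (p w - p (w + z))"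
            using proportional[of "p z - p w" "p w - p (w + z)" "- ?l" "?k + ?l"] S(5) pw pz q 3 greater
            by simp
          have "u (p (w + z)) \<in> P" using wz greater by (auto simp: h'_def \<kappa>_add split: if_splits)
          then have "h (p w - p (w + z)) \<in> P \<or> u (p w) \<in> P"
            by (rule cutP(1)[OF q(1) pw(1)])
          then show ?thesis using concl eq less by (auto simp: h'_def)
        next
          case less': less
          then have q: "p (w + z) \<in> W" "scale (?k + ?l) (p (w + z)) = scale (?k + ?l) x - (w + z)"
            using p_W[OF wz_W] p[of "w + z"] by (auto simp: \<kappa>_add)
          have "scale ?k (p z - p w) = scale (- (?k + ?l)) (p (w + z) - p z)"
            unfolding minus_scale using p_add[of w z] 3 less less'
            by (simp add: scale_diff add_scale algebra_simps)
          then have eq: "h (p z - p w) = h (p (w + z) - p z)"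
            using proportional[OF S(5)[OF pz(1) pw(1)] S(5)[OF q(1) pz(1)] less] less'
            by (metis neg_0_less_iff_less)
          have "v (p (w + z)) \<in> P" using wz less' by (auto simp: h'_def \<kappa>_add split: if_splits)
          then have "h (p (w + z) - p z) \<in> P \<or> v (p z) \<in> P"
            by (rule cutP(2)[OF q(1) pz(1)])
          then show ?thesis using concl eq 3 by (auto simp: h'_def)
        qed
      qed
    qed
    \<comment> \<open>This mirrors the first two cases above, with \<open>v\<close> in place of
      \<open>u\<close>.\<close>
    have neg_case: "h' w \<in> P \<or> h' z \<in> P"
      if w: "w \<in> W'" and z: "z \<in> W'" and wz: "h' (w + z) \<in> P"
        and less: "\<kappa> w < 0" "\<kappa> z \<le> 0" for w z
    proof -
      let ?k = "\<kappa> w" and ?l = "\<kappa> z"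
      have wz_W: "w + z \<in> W'" using W'_add w z by blast
      have neg: "?k + ?l < 0" using less by (simp add: add_neg_nonpos)
      have pw: "p w \<in> W" "scale ?k (p w) = scale ?k x - w"
        using p_W w less p by auto
      have q: "p (w + z) \<in> W" "scale (?k + ?l) (p (w + z)) = scale (?k + ?l) x - (w + z)"
        using p_W[OF wz_W] p[of "w + z"] neg by (auto simp: \<kappa>_add)
      have vq: "v (p (w + z)) \<in> P" using wz neg by (auto simp: h'_def \<kappa>_add split: if_splits)
      show ?thesis
      proof (cases "?l = 0")
        case True
        have "scale (- ?k) (p (w + z) - p w) = scale 1 z"
          using pw(2) q(2) True by (simp add: scale_diff minus_scale one_scale)
        then have "h (p (w + z) - p w) = h z"
          using proportional[of "p (w + z) - p w" z "- ?k" 1] W'_W[OF z] S(5) pw q True less one_pos by simp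
        then show ?thesis
          using cutP(2)[OF q(1) pw(1) vq] True less by (auto simp: h'_def)
      next
        case False
        then have pz: "p z \<in> W" "scale ?l (p z) = scale ?l x - z"
          using p_W z p by auto
        have "scale (- ?k) (p (w + z) - p w) = - scale (- ?l) (p (w + z) - p z)"
          using p_add[of w z] False less neg
          by (simp add: scale_diff add_scale minus_scale algebra_simps)
        then have "\<not> (h (p (w + z) - p w) \<in> P \<and> h (p (w + z) - p z) \<in> P)"
          using neg_prop[of "p (w + z) - p w" "p (w + z) - p z" "- ?k" "- ?l"] S(5) pw pz q False less
          by simp
        then show ?thesis
          using cutP(2)[OF q(1) pw(1) vq] cutP(2)[OF q(1) pz(1) vq] False less
          by (auto simp: h'_def)
      qed
    qed
    have zero: "h' w \<in> P \<or> h' z \<in> P" if "\<kappa> w = 0" "\<kappa> z = 0"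
      using val(2)[of w z] that W'_W w z wz by (simp add: h'_def \<kappa>_add)
    have zw: "h' (z + w) \<in> P" using wz by (simp add: add.commute)
    have "h' w \<in> P \<or> h' z \<in> P"
      using pos_case[OF w z wz] pos_case[OF z w zw] neg_case[OF w z wz] neg_case[OF z w zw] zero
      by (metis less_le not_le)
    then show "sup (h' w) (h' z) \<in> P"
      by (simp add: prime_filterD[OF P])
  qed
  show thesis
  proof (rule that)
    show "valuation W' h'"
      using hom opp sub by (simp add: valuation_def)
    show "h' x = l" "h' (- x) = bot"
      using one_pos[where 'k = 'k] less_not_sym[OF one_pos[where 'k = 'k]] p_scale[of "- 1" x]
      by (simp_all add: h'_def \<kappa>_minus \<kappa>_x p_def minus_scale one_scale u_def v_def idx0 u0)
  qed (rule h'_W)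
qed

end

section \<open>The free vector lattice as a lattice-ordered group\<close>

lemma vcar_free_vl_UNIV [simp]:
  "vcar (free_vl UNIV :: ('k::{division_ring,linordered_ring}, ('i, 'k) fvl) vlat) = UNIV"
proof -
  have "x \<in> range abs_fvl" for x :: "('i, 'k) fvl"
    by (rule range_eqI[of _ _ "rep_fvl x"]) (simp add: Quotient_abs_rep[OF Quotient_fvl])
  then show ?thesis by auto
qed

text \<open>With the whole quotient type as a lattice-ordered group, positive parts and the
  distribution laws for sums become available. Each \<open>free_vl I\<close> is then a subset closed
  under the operations, with the induced order.\<close>

instantiation fvl :: (type, "{division_ring,linordered_ring}") lattice_ab_group_add
begin

definition "0 = fzero"
definition "x + y = fadd x y"
definition "- x = fneg x"
definition "x - y = fadd x (fneg y)" for x y :: "('a, 'b) fvl"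
definition "sup x y = fjoin x y"
definition "inf x y = fmeet x y"
definition "x \<le> y \<longleftrightarrow> fjoin x y = y"
definition "x < y \<longleftrightarrow> fjoin x y = y \<and> x \<noteq> y" for x y :: "('a, 'b) fvl"

instance
proof -
  interpret V: vector_lattice "free_vl UNIV :: ('b, ('a, 'b) fvl) vlat"
    by (rule vector_lattice_free_vl)
  note ax = V.add_assoc V.add_comm V.add_zero V.add_neg V.join_comm V.join_assoc V.meet_comm V.meet_assoc
    V.join_meet_absorb V.meet_join_absorb V.add_mono[unfolded vle_def]
  note ax' = ax[unfolded vcar_free_vl_UNIV free_vl_simps(2-), simplified]
  have idem: "fjoin x x = x" for x :: "('a, 'b) fvl"
    by (metis ax'(9,10))
  have meet: "fmeet x y = x \<longleftrightarrow> fjoin x y = y" for x y :: "('a, 'b) fvl"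
    by (metis ax'(5,7,9,10))
  show "OFCLASS(('a, 'b) fvl, lattice_ab_group_add_class)"
  proof
    fix x y z :: "('a, 'b) fvl"
    show "x + y + z = x + (y + z)" "x + y = y + x" "0 + x = x" "- x + x = 0" "x - y = x + - y"
      unfolding zero_fvl_def plus_fvl_def uminus_fvl_def minus_fvl_def
      using ax'(1-4) by metis+
    show "x \<le> y \<Longrightarrow> z + x \<le> z + y"
      unfolding less_eq_fvl_def plus_fvl_def using ax'(2,11) by metis
    show "(x < y) = (x \<le> y \<and> \<not> y \<le> x)" "x \<le> y \<Longrightarrow> y \<le> x \<Longrightarrow> x = y"
      unfolding less_eq_fvl_def less_fvl_def using ax'(5) by metis+
    show "x \<le> x" unfolding less_eq_fvl_def by (rule idem)
    show "x \<le> y \<Longrightarrow> y \<le> z \<Longrightarrow> x \<le> z"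
      unfolding less_eq_fvl_def using ax'(6) by metis
    show "x \<le> sup x y" "y \<le> sup x y"
      unfolding less_eq_fvl_def sup_fvl_def using ax'(5,6) idem by metis+
    show "y \<le> x \<Longrightarrow> z \<le> x \<Longrightarrow> sup y z \<le> x"
      unfolding less_eq_fvl_def sup_fvl_def using ax'(6) by metis
    show "inf x y \<le> x" "inf x y \<le> y"
      unfolding less_eq_fvl_def inf_fvl_def using ax'(5,7,9) by metis+
    show "x \<le> y \<Longrightarrow> x \<le> z \<Longrightarrow> x \<le> inf y z"
      unfolding less_eq_fvl_def inf_fvl_def meet[symmetric] using ax'(8) by metis
  qed
qed

end

lemma free_vl_ops [simp]:
  "fzero = 0" "fadd x y = x + y" "fneg x = - x" "fjoin x y = sup x y" "fmeet x y = inf x y"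
  by (simp_all add: zero_fvl_def plus_fvl_def uminus_fvl_def sup_fvl_def inf_fvl_def)

lemma vle_free_vl [simp]: "vle (free_vl I) x y \<longleftrightarrow> x \<le> y"
  by (simp add: vle_def le_iff_sup)

lemma free_vl_closed:
  fixes x y :: "('i, 'k::{division_ring,linordered_ring}) fvl"
  shows "0 \<in> vcar (free_vl I :: ('k, ('i, 'k) fvl) vlat)"
    and "x \<in> vcar (free_vl I) \<Longrightarrow> y \<in> vcar (free_vl I) \<Longrightarrow> x + y \<in> vcar (free_vl I)"
    and "x \<in> vcar (free_vl I) \<Longrightarrow> - x \<in> vcar (free_vl I)"
    and "x \<in> vcar (free_vl I) \<Longrightarrow> fsmul a x \<in> vcar (free_vl I)"
    and "x \<in> vcar (free_vl I) \<Longrightarrow> y \<in> vcar (free_vl I) \<Longrightarrow> sup x y \<in> vcar (free_vl I)"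
    and "x \<in> vcar (free_vl I) \<Longrightarrow> y \<in> vcar (free_vl I) \<Longrightarrow> inf x y \<in> vcar (free_vl I)"
proof -
  interpret vector_lattice "free_vl I :: ('k, ('i, 'k) fvl) vlat"
    by (rule vector_lattice_free_vl)
  show "0 \<in> vcar (free_vl I :: ('k, ('i, 'k) fvl) vlat)"
    and "x \<in> vcar (free_vl I) \<Longrightarrow> y \<in> vcar (free_vl I) \<Longrightarrow> x + y \<in> vcar (free_vl I)"
    and "x \<in> vcar (free_vl I) \<Longrightarrow> - x \<in> vcar (free_vl I)"
    and "x \<in> vcar (free_vl I) \<Longrightarrow> fsmul a x \<in> vcar (free_vl I)"
    and "x \<in> vcar (free_vl I) \<Longrightarrow> y \<in> vcar (free_vl I) \<Longrightarrow> sup x y \<in> vcar (free_vl I)"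
    and "x \<in> vcar (free_vl I) \<Longrightarrow> y \<in> vcar (free_vl I) \<Longrightarrow> inf x y \<in> vcar (free_vl I)"
    using zero_closed add_closed[of x y] neg_closed[of x] smul_closed[of x a]
      join_closed[of x y] meet_closed[of x y]
    by (simp_all only: free_vl_simps(2-) free_vl_ops)
qed

section \<open>Scalar multiplication and the order\<close>

global_interpretation fvl: left_vector_space
  "fsmul :: 'k::{division_ring,linordered_ring} \<Rightarrow> ('i, 'k) fvl \<Rightarrow> ('i, 'k) fvl"
proof -
  interpret vector_lattice "free_vl UNIV :: ('k, ('i, 'k) fvl) vlat"
    by (rule vector_lattice_free_vl)
  show "left_vector_space (fsmul :: 'k \<Rightarrow> ('i, 'k) fvl \<Rightarrow> ('i, 'k) fvl)"
    by unfold_locales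
      (use smul_add add_smul mult_smul one_smul in \<open>simp_all del: free_vl_simps(1)\<close>)
qed

lemma fsmul_nonneg:
  fixes x :: "('i, 'k::{division_ring,linordered_ring}) fvl"
  assumes "0 \<le> a" "0 \<le> x"
  shows "0 \<le> fsmul a x"
  using vector_lattice.smul_nonneg[OF vector_lattice_free_vl[of UNIV], of x a] assms
  by (simp del: free_vl_simps(1))

lemma fsmul_mono:
  fixes x y :: "('i, 'k::{division_ring,linordered_ring}) fvl"
  assumes "0 \<le> a" "x \<le> y"
  shows "fsmul a x \<le> fsmul a y"
  using fsmul_nonneg[of a "y - x"] assms by (simp add: fvl.scale_diff)

lemma fsmul_mono_left:
  fixes x :: "('i, 'k::{division_ring,linordered_ring}) fvl"
  assumes "a \<le> b" "0 \<le> x"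
  shows "fsmul a x \<le> fsmul b x"
proof -
  have "0 \<le> fsmul (b - a) x" using assms by (intro fsmul_nonneg) simp_all
  then have "fsmul a x + 0 \<le> fsmul a x + fsmul (b - a) x" by (rule add_left_mono)
  then show ?thesis by (simp flip: fvl.add_scale)
qed

text \<open>Scaling by a positive \<open>a\<close> is monotone with monotone inverse, hence an
  automorphism of the order.\<close>

lemma fsmul_sup_inf:
  fixes x y :: "('i, 'k::{division_ring,linordered_ring}) fvl"
  assumes "0 \<le> a"
  shows "fsmul a (sup x y) = sup (fsmul a x) (fsmul a y)"
    and "fsmul a (inf x y) = inf (fsmul a x) (fsmul a y)"
proof -
  have *: "fsmul a (sup x y) = sup (fsmul a x) (fsmul a y) \<and>
      fsmul a (inf x y) = inf (fsmul a x) (fsmul a y)"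
  proof (cases "a = 0")
    case False
    then have "0 < a" using assms by (simp add: less_le)
    then have pos: "0 \<le> inverse a" by (intro less_imp_le inverse_pos)
    have inv: "fsmul a (fsmul (inverse a) z) = z" "fsmul (inverse a) (fsmul a z) = z"
      for z :: "('i, 'k) fvl"
      using False by (simp_all add: fvl.one_scale flip: fvl.mult_scale)
    have le: "sup (fsmul b z) (fsmul b w) \<le> fsmul b (sup z w)"
      "fsmul b (inf z w) \<le> inf (fsmul b z) (fsmul b w)" if "0 \<le> b" for b and z w :: "('i, 'k) fvl"
      by (simp_all add: fsmul_mono[OF that])
    show ?thesis
      using le[OF assms, of x y] fsmul_mono[OF assms le(1)[OF pos, of "fsmul a x" "fsmul a y"]]
        fsmul_mono[OF assms le(2)[OF pos, of "fsmul a x" "fsmul a y"]]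
      unfolding inv by (intro conjI antisym)
  qed simp
  then show "fsmul a (sup x y) = sup (fsmul a x) (fsmul a y)"
    and "fsmul a (inf x y) = inf (fsmul a x) (fsmul a y)" by blast+
qed

section \<open>Linear spans of the generators\<close>

inductive_set lin_span :: "'i set \<Rightarrow> ('i, 'k::{division_ring,linordered_ring}) fvl set" for I where
  lin_gen: "i \<in> I \<Longrightarrow> fgen i \<in> lin_span I"
| lin_zero: "0 \<in> lin_span I"
| lin_add: "x \<in> lin_span I \<Longrightarrow> y \<in> lin_span I \<Longrightarrow> x + y \<in> lin_span I"
| lin_smul: "x \<in> lin_span I \<Longrightarrow> fsmul a x \<in> lin_span I"

lemma subspace_lin: "fvl.subspace (lin_span I)"
  by (simp add: fvl.subspace_def lin_span.intros)

lemma lin_mono: "I \<subseteq> J \<Longrightarrow> lin_span I \<subseteq> lin_span J"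
proof
  fix x :: "('a, 'b) fvl" assume "x \<in> lin_span I" "I \<subseteq> J"
  then show "x \<in> lin_span J" by induction (auto intro: lin_span.intros)
qed

text \<open>Every element is the value of a finite list of pairs of a coefficient and a generator,
  and there are only countably many such lists.\<close>

lemma countable_lin:
  assumes "countable (UNIV :: 'k::{division_ring,linordered_ring} set)" "countable I"
  shows "countable (lin_span I :: ('i, 'k) fvl set)"
proof -
  let ?e = "\<lambda>(a :: 'k, i). fsmul a (fgen i :: ('i, 'k) fvl)"
  let ?s = "\<lambda>l. sum_list (map ?e l)"
  have "x \<in> ?s ` lists (UNIV \<times> I)" if "x \<in> lin_span I" for x
    using that
  proof induction
    case (lin_gen i)
    then show ?case by (intro image_eqI[of _ _ "[(1, i)]"]) (simp_all add: fvl.one_scale)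
  next
    case lin_zero
    then show ?case by (intro image_eqI[of _ _ "[]"]) simp_all
  next
    case (lin_add x y)
    then obtain k l where "x = ?s k" "k \<in> lists (UNIV \<times> I)" "y = ?s l" "l \<in> lists (UNIV \<times> I)"
      by blast
    then show ?case by (intro image_eqI[of _ _ "k @ l"]) simp_all
  next
    case (lin_smul x b)
    then obtain k where k: "x = ?s k" "k \<in> lists (UNIV \<times> I)"
      by blast
    have "fsmul b (?s l) = ?s (map (\<lambda>(a, i). (b * a, i)) l)" for l
      by (induction l) (auto simp: fvl.scale_add fvl.mult_scale)
    then show ?case
      using k by (intro image_eqI[of _ _ "map (\<lambda>(a, i). (b * a, i)) k"]) (auto simp: in_lists_conv_set)
  qed
  then have "lin_span I \<subseteq> ?s ` lists (UNIV \<times> I)" by blast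
  then show ?thesis
    using assms by (rule countable_subset[OF _ countable_image[OF countable_lists[OF countable_SIGMA]]])
qed

lemma lin_insert:
  "lin_span (insert j I) = {fsmul a (fgen j) + c | a c. c \<in> lin_span I}" (is "_ = ?R")
proof
  show "lin_span (insert j I) \<subseteq> ?R"
  proof
    fix x :: "('a, 'b) fvl" assume "x \<in> lin_span (insert j I)"
    then show "x \<in> ?R"
    proof induction
      case (lin_gen i)
      show ?case
      proof (cases "i = j")
        case True
        then show ?thesis
          by (intro CollectI exI[of _ 1] exI[of _ 0]) (simp add: fvl.one_scale lin_zero)
      next
        case False
        then show ?thesis
          using lin_gen by (intro CollectI exI[of _ 0] exI[of _ "fgen i"]) (simp add: lin_span.lin_gen)
      qed
    next
      case lin_zero
      show ?case by (intro CollectI exI[of _ 0]) (simp add: lin_span.lin_zero)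
    next
      case (lin_add x y)
      then obtain a c b d where "x = fsmul a (fgen j) + c" "c \<in> lin_span I"
        "y = fsmul b (fgen j) + d" "d \<in> lin_span I" by blast
      then show ?case
        by (intro CollectI exI[of _ "a + b"] exI[of _ "c + d"])
          (simp add: fvl.add_scale lin_span.lin_add algebra_simps)
    next
      case (lin_smul x b)
      then obtain a c where "x = fsmul a (fgen j) + c" "c \<in> lin_span I" by blast
      then show ?case
        by (intro CollectI exI[of _ "b * a"] exI[of _ "fsmul b c"])
          (simp add: fvl.mult_scale fvl.scale_add lin_span.lin_smul)
    qed
  qed
  show "?R \<subseteq> lin_span (insert j I)"
    using lin_mono[of I "insert j I"] by (auto intro!: lin_add lin_smul lin_gen)
qed

section \<open>Coordinate functionals\<close>

definition scalar_vlat :: "('k::{division_ring,linordered_ring}, 'k) vlat" where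
  "scalar_vlat = \<lparr>vcar = UNIV, vzero = 0, vadd = (+), vneg = uminus, vsmul = (*),
    vjoin = max, vmeet = min\<rparr>"

lemma vector_lattice_scalar: "vector_lattice scalar_vlat"
  by unfold_locales (auto simp: scalar_vlat_def vle_def algebra_simps max_def min_def split: if_splits)

text \<open>Evaluation of terms in the scalars separates a generator from the span of the others.
  This is the functional \<open>\<kappa>\<close> needed by \<open>valuation_extend\<close>.\<close>

lift_definition coordinate :: "'i \<Rightarrow> ('i, 'k::{division_ring,linordered_ring}) fvl \<Rightarrow> 'k"
  is "\<lambda>j. term_eval scalar_vlat (\<lambda>i. if i = j then 1 else 0)"
  by (rule vector_lattice.term_eval_vleq[OF vector_lattice_scalar]) (simp_all add: scalar_vlat_def)

lemma coordinate_simps: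
  "coordinate j (fgen i) = (if i = j then 1 else 0)" "coordinate j 0 = 0"
  "coordinate j (x + y) = coordinate j x + coordinate j y"
  "coordinate j (fsmul a x) = a * coordinate j x"
  unfolding zero_fvl_def plus_fvl_def by (transfer, simp add: scalar_vlat_def)+

lemma coordinate_lin: "x \<in> lin_span I \<Longrightarrow> j \<notin> I \<Longrightarrow> coordinate j x = 0"
  by (induction rule: lin_span.induct) (auto simp: coordinate_simps)

section \<open>Lattice combinations of linear elements\<close>

inductive_set lattice_span :: "'i set \<Rightarrow> ('i, 'k::{division_ring,linordered_ring}) fvl set" for I where
  lattice_span_lin: "x \<in> lin_span I \<Longrightarrow> x \<in> lattice_span I"
| lattice_span_sup: "x \<in> lattice_span I \<Longrightarrow> y \<in> lattice_span I \<Longrightarrow> sup x y \<in> lattice_span I"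
| lattice_span_inf: "x \<in> lattice_span I \<Longrightarrow> y \<in> lattice_span I \<Longrightarrow> inf x y \<in> lattice_span I"

lemma lattice_span_add: "x \<in> lattice_span I \<Longrightarrow> y \<in> lattice_span I \<Longrightarrow> x + y \<in> lattice_span I"
proof (induction arbitrary: y rule: lattice_span.induct)
  case (lattice_span_lin x)
  from lattice_span_lin(2) show ?case
    by induction (use lattice_span_lin(1) in \<open>auto simp: add_sup_inf_distribs intro: lattice_span.intros lin_add\<close>)
qed (auto simp: add_sup_inf_distribs intro: lattice_span.intros)

lemma lattice_span_neg: "x \<in> lattice_span I \<Longrightarrow> - x \<in> lattice_span I"
  by (induction rule: lattice_span.induct)
    (auto simp: neg_sup_eq_inf neg_inf_eq_sup intro: lattice_span.intros fvl.subspaceD(4)[OF subspace_lin])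

lemma lattice_span_smul: "x \<in> lattice_span I \<Longrightarrow> fsmul a x \<in> lattice_span I"
proof -
  have *: "fsmul b x \<in> lattice_span I" if "0 \<le> b" "x \<in> lattice_span I" for b and x :: "('a, 'b) fvl"
    using that(2) by induction (use that(1) in \<open>auto simp: fsmul_sup_inf intro: lattice_span.intros lin_smul\<close>)
  assume "x \<in> lattice_span I"
  then show ?thesis
    using *[of a x] lattice_span_neg[OF *[of "- a" x]] by (cases "0 \<le> a") (simp_all add: fvl.minus_scale)
qed

text \<open>Sums distribute over joins and meets, negation exchanges the two, and nonnegative
  scalars preserve both; so all operations can be pushed inwards to the linear elements. This gives
  an induction principle whose only steps are joins and meets.\<close>

lemma vcar_free_vl_eq_lattice_span: "vcar (free_vl I) = lattice_span I"
proof
  show "vcar (free_vl I) \<subseteq> (lattice_span I :: ('a, 'b) fvl set)"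
  proof
    fix x :: "('a, 'b) fvl" assume "x \<in> vcar (free_vl I)"
    then obtain t where x: "x = abs_fvl t" and t: "vars t \<subseteq> I" by auto
    from t have "abs_fvl t \<in> lattice_span I"
    proof (induction t)
      case (Var i)
      then have "fgen i \<in> (lattice_span I :: ('a, 'b) fvl set)" by (intro lattice_span_lin lin_gen) simp
      then show ?case by (simp add: abs_fvl_simps)
    next
      case Zero
      have "0 \<in> (lattice_span I :: ('a, 'b) fvl set)" by (intro lattice_span_lin lin_zero)
      then show ?case by (simp flip: abs_fvl_simps)
    qed (simp_all add: lattice_span_add lattice_span_neg lattice_span_smul lattice_span_sup lattice_span_inf flip: abs_fvl_simps)
    then show "x \<in> lattice_span I" unfolding x .
  qed
  show "lattice_span I \<subseteq> vcar (free_vl I :: ('b, ('a, 'b) fvl) vlat)"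
  proof
    fix x :: "('a, 'b) fvl" assume "x \<in> lattice_span I"
    then show "x \<in> vcar (free_vl I)"
    proof induction
      case (lattice_span_lin x)
      then show ?case
      proof induction
        case (lin_gen i)
        then show ?case by (rule fgen_in_free_vl)
      qed (rule free_vl_closed; assumption)+
    qed (rule free_vl_closed; assumption)+
  qed
qed

section \<open>Principal ideals of the free vector lattice\<close>

declare free_vl_simps(1) [simp del]

text \<open>The difference \<open>pprt c - c = pprt (- c)\<close> decreases as \<open>c\<close>
  grows, so for \<open>c\<close> above \<open>inf a b\<close> it is at most its value at
  \<open>inf a b\<close>. Adding that constant commutes with the meet of \<open>a\<close> and
  \<open>b\<close>.\<close>

lemma pprt_inf: "pprt (inf a b) = inf (pprt a) (pprt b)" for a b :: "'a::lattice_ab_group_add"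
proof (rule antisym)
  let ?m = "inf a b"
  have le: "pprt c \<le> c + (pprt ?m - ?m)" if "?m \<le> c" for c
  proof -
    have *: "pprt c - c = pprt (- c)" for c :: 'a
      using prts[of c] by (simp add: pprt_neg algebra_simps)
    have "pprt c - c \<le> pprt ?m - ?m"
      unfolding * using that by (intro pprt_mono le_imp_neg_le)
    then show ?thesis by (simp add: algebra_simps)
  qed
  have "inf (pprt a) (pprt b) \<le> inf (a + (pprt ?m - ?m)) (b + (pprt ?m - ?m))"
    by (intro inf_mono le) simp_all
  also have "\<dots> = pprt ?m"
    by (simp only: add.commute[of ?m] diff_add_cancel flip: add_inf_distrib_right)
  finally show "inf (pprt a) (pprt b) \<le> pprt ?m" .
qed simp

section \<open>Elements of ideals\<close>

lemma principal_ideal_self: "x \<in> principal_ideal V x"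
  by (simp add: principal_ideal_def)

lemma principal_ideal_least: "l_ideal V A \<Longrightarrow> x \<in> A \<Longrightarrow> principal_ideal V x \<subseteq> A"
  by (auto simp: principal_ideal_def)

lemma l_ideal_vcar: "vector_lattice V \<Longrightarrow> l_ideal V (vcar V)"
  by (auto simp: l_ideal_def vector_lattice_def)

lemma l_ideal_principal:
  assumes "vector_lattice V" "x \<in> vcar V"
  shows "l_ideal V (principal_ideal V x)"
proof -
  have "principal_ideal V x \<subseteq> vcar V"
    using assms by (intro principal_ideal_least l_ideal_vcar)
  then show ?thesis
    unfolding l_ideal_def principal_ideal_def by blast
qed

lemma l_ideal_free_vl:
  "l_ideal (free_vl I) A \<longleftrightarrow> A \<subseteq> vcar (free_vl I) \<and> 0 \<in> A \<and> (\<forall>x\<in>A. \<forall>y\<in>A. x + y \<in> A) \<and>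
    (\<forall>a. \<forall>x\<in>A. fsmul a x \<in> A) \<and> (\<forall>x\<in>A. \<forall>y\<in>A. sup x y \<in> A) \<and> (\<forall>x\<in>A. \<forall>y\<in>A. inf x y \<in> A) \<and>
    (\<forall>x\<in>A. \<forall>y\<in>A. \<forall>z\<in>vcar (free_vl I). x \<le> z \<and> z \<le> y \<longrightarrow> z \<in> A)"
  by (simp add: l_ideal_def)

lemma l_ideal_freeD:
  assumes "l_ideal (free_vl I) A"
  shows "x \<in> A \<Longrightarrow> x \<in> vcar (free_vl I)" "0 \<in> A" "x \<in> A \<Longrightarrow> y \<in> A \<Longrightarrow> x + y \<in> A"
    "x \<in> A \<Longrightarrow> fsmul a x \<in> A" "x \<in> A \<Longrightarrow> y \<in> A \<Longrightarrow> sup x y \<in> A" "x \<in> A \<Longrightarrow> y \<in> A \<Longrightarrow> inf x y \<in> A"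
    "x \<in> A \<Longrightarrow> y \<in> A \<Longrightarrow> z \<in> vcar (free_vl I) \<Longrightarrow> x \<le> z \<Longrightarrow> z \<le> y \<Longrightarrow> z \<in> A"
proof -
  have A: "A \<subseteq> vcar (free_vl I)" "0 \<in> A" "\<forall>x\<in>A. \<forall>y\<in>A. x + y \<in> A" "\<forall>a. \<forall>x\<in>A. fsmul a x \<in> A"
    "\<forall>x\<in>A. \<forall>y\<in>A. sup x y \<in> A" "\<forall>x\<in>A. \<forall>y\<in>A. inf x y \<in> A"
    "\<forall>x\<in>A. \<forall>y\<in>A. \<forall>z\<in>vcar (free_vl I). x \<le> z \<and> z \<le> y \<longrightarrow> z \<in> A"
    using assms unfolding l_ideal_free_vl by - (elim conjE, assumption)+
  show "0 \<in> A" by (rule A(2))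
  show "x \<in> A \<Longrightarrow> x \<in> vcar (free_vl I)" using A(1) by blast
  show "x \<in> A \<Longrightarrow> y \<in> A \<Longrightarrow> x + y \<in> A" using A(3) by blast
  show "x \<in> A \<Longrightarrow> fsmul a x \<in> A" using A(4) by blast
  show "x \<in> A \<Longrightarrow> y \<in> A \<Longrightarrow> sup x y \<in> A" using A(5) by blast
  show "x \<in> A \<Longrightarrow> y \<in> A \<Longrightarrow> inf x y \<in> A" using A(6) by blast
  show "x \<in> A \<Longrightarrow> y \<in> A \<Longrightarrow> z \<in> vcar (free_vl I) \<Longrightarrow> x \<le> z \<Longrightarrow> z \<le> y \<Longrightarrow> z \<in> A"
    using A(7) by blast
qed

lemma l_ideal_minus:
  assumes "l_ideal (free_vl I) A" "x \<in> A"
  shows "- x \<in> A"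
proof -
  have "fsmul (- 1) x \<in> A" using assms by (rule l_ideal_freeD(4))
  then show ?thesis by (simp add: fvl.minus_scale fvl.one_scale)
qed

lemma l_ideal_convex:
  assumes "l_ideal (free_vl I) A" "x \<in> A" "z \<in> vcar (free_vl I)" "z \<le> x" "- z \<le> x"
  shows "z \<in> A"
proof -
  have "- x \<in> A" using assms by (intro l_ideal_minus)
  moreover have "- x \<le> z" using assms(5) by (simp add: minus_le_iff)
  ultimately show ?thesis using l_ideal_freeD(7)[OF assms(1) _ assms(2,3)] assms(4) by blast
qed

text \<open>The elements bounded in absolute value by a multiple of \<open>x\<close> form an ideal
  containing \<open>x\<close>, so they include the principal one.\<close>

lemma principal_ideal_bound:
  fixes x :: "('i, 'k::{division_ring,linordered_ring}) fvl"
  assumes x: "x \<in> vcar (free_vl I)" "0 \<le> x" and z: "z \<in> principal_ideal (free_vl I) x"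
  obtains a where "0 \<le> a" "z \<le> fsmul a x" "- z \<le> fsmul a x"
proof -
  let ?A = "{z \<in> vcar (free_vl I). \<exists>a\<ge>0. z \<le> fsmul a x \<and> - z \<le> fsmul a x}"
  \<comment> \<open>Since \<open>x\<close> is nonnegative, the larger of two scalars gives a common
    bound.\<close>
  have bound: "\<exists>c\<ge>0. fsmul a x \<le> fsmul c x \<and> fsmul b x \<le> fsmul c x" if "0 \<le> a" for a b
    using that x(2) by (intro exI[of _ "max a b"]) (auto intro: fsmul_mono_left simp: le_max_iff_disj)
  have "l_ideal (free_vl I) ?A"
    unfolding l_ideal_free_vl
  proof (intro conjI ballI allI impI)
    show "?A \<subseteq> vcar (free_vl I)" by blast
    show "0 \<in> ?A" using free_vl_closed(1) by (auto intro!: exI[of _ 0])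
  next
    fix w z assume "w \<in> ?A" "z \<in> ?A"
    then obtain a b where wz: "w \<in> vcar (free_vl I)" "z \<in> vcar (free_vl I)" and a: "0 \<le> a" "w \<le> fsmul a x" "- w \<le> fsmul a x"
      and b: "0 \<le> b" "z \<le> fsmul b x" "- z \<le> fsmul b x" by blast
    have "w + z \<le> fsmul (a + b) x" "- (w + z) \<le> fsmul (a + b) x"
      using add_mono[OF a(2) b(2)] add_mono[OF a(3) b(3)]
      by (simp_all add: fvl.add_scale)
    then show "w + z \<in> ?A"
      using a b wz free_vl_closed(2)[of w I z] add_nonneg_nonneg[of a b] by blast
    obtain c where c: "0 \<le> c" "fsmul a x \<le> fsmul c x" "fsmul b x \<le> fsmul c x"
      using bound[OF a(1)] by blast
    have *: "w \<le> fsmul c x" "- w \<le> fsmul c x" "z \<le> fsmul c x" "- z \<le> fsmul c x"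
      using a b c order_trans by blast+
    then have "sup w z \<le> fsmul c x" "- sup w z \<le> fsmul c x" "inf w z \<le> fsmul c x" "- inf w z \<le> fsmul c x"
      by (auto simp: neg_sup_eq_inf neg_inf_eq_sup intro: le_infI1)
    then show "sup w z \<in> ?A" "inf w z \<in> ?A"
      using c(1) wz free_vl_closed(5,6)[of w I z] by blast+
  next
    fix b :: 'k and z assume "z \<in> ?A"
    then obtain a where z: "z \<in> vcar (free_vl I)" and a: "0 \<le> a" "z \<le> fsmul a x" "- z \<le> fsmul a x"
      by blast
    have "fsmul b z \<le> fsmul (\<bar>b\<bar> * a) x \<and> - fsmul b z \<le> fsmul (\<bar>b\<bar> * a) x"
    proof (cases "0 \<le> b")
      case True
      then show ?thesis
        using fsmul_mono[OF True a(2)] fsmul_mono[OF True a(3)]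
        by (simp add: fvl.mult_scale fvl.scale_minus)
    next
      case False
      then have b: "0 \<le> - b" by simp
      then show ?thesis
        using fsmul_mono[OF b a(2)] fsmul_mono[OF b a(3)] False
        by (simp add: fvl.mult_scale fvl.scale_minus fvl.minus_scale)
    qed
    moreover have "0 \<le> \<bar>b\<bar> * a" using a by simp
    ultimately show "fsmul b z \<in> ?A" using z free_vl_closed(4) by blast
  next
    fix w z y assume "w \<in> ?A" "z \<in> ?A" and y: "y \<in> vcar (free_vl I)" "w \<le> y \<and> y \<le> z"
    then obtain a b where a: "0 \<le> a" "- w \<le> fsmul a x" and b: "0 \<le> b" "z \<le> fsmul b x" by blast
    obtain c where c: "0 \<le> c" "fsmul a x \<le> fsmul c x" "fsmul b x \<le> fsmul c x"
      using bound[OF a(1)] by blast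
    have "y \<le> fsmul c x" using y(2) b(2) c(3) order_trans by blast
    moreover have "- y \<le> - w" using y(2) by simp
    then have "- y \<le> fsmul c x" using a(2) c(2) order_trans by blast
    ultimately show "y \<in> ?A" using y c(1) by blast
  qed
  moreover have "- x \<le> x" using x(2) by (meson neg_le_0_iff_le order_trans)
  then have "x \<in> ?A"
    using x(1) one_pos[where 'k = 'k] by (auto intro!: exI[of _ 1] simp: fvl.one_scale less_imp_le)
  ultimately have "z \<in> ?A" using z by (rule principal_ideal_least[THEN subsetD])
  then show thesis using that by blast
qed

lemma isLub_pair: "isLub S {A, B} C \<longleftrightarrow> C \<in> S \<and> A \<le> C \<and> B \<le> C \<and> (\<forall>D\<in>S. A \<le> D \<longrightarrow> B \<le> D \<longrightarrow> C \<le> D)"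
  for A B C :: "'a::order"
  by (auto simp: isLub_def leastP_def isUb_def setle_def setge_def)

lemma isGlb_pair: "isGlb S {A, B} C \<longleftrightarrow> C \<in> S \<and> C \<le> A \<and> C \<le> B \<and> (\<forall>D\<in>S. D \<le> A \<longrightarrow> D \<le> B \<longrightarrow> D \<le> C)"
  for A B C :: "'a::order"
  by (auto simp: isGlb_def greatestP_def isLb_def setle_def setge_def)

section \<open>Joins and meets of principal ideals\<close>

context
  fixes I :: "'i set"
begin

abbreviation (input) car :: "('i, 'k::{division_ring,linordered_ring}) fvl set" where
  "car \<equiv> vcar (free_vl I)"

abbreviation (input) pid :: "('i, 'k::{division_ring,linordered_ring}) fvl \<Rightarrow> ('i, 'k) fvl set" where
  "pid \<equiv> principal_ideal (free_vl I)"

lemma pid_le_iff: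
  assumes "y \<in> car"
  shows "pid x \<subseteq> pid y \<longleftrightarrow> x \<in> pid y"
  using principal_ideal_least[OF l_ideal_principal[OF vector_lattice_free_vl assms], of x]
    principal_ideal_self[of x "free_vl I"] by blast

lemma pprt_car: "x \<in> car \<Longrightarrow> pprt x \<in> car"
  unfolding pprt_def by (intro free_vl_closed)

text \<open>The join is the absolute value of \<open>x\<close>. Thus every principal ideal has a
  nonnegative generator, and one that splits into two positive parts to which a homomorphism can be
  applied separately.\<close>

lemma pid_sup_pprt:
  assumes "x \<in> car"
  shows "pid (sup (pprt x) (pprt (- x))) = pid x"
proof
  have c: "sup (pprt x) (pprt (- x)) \<in> car"
    using assms by (intro free_vl_closed pprt_car)
  note I = l_ideal_principal[OF vector_lattice_free_vl assms]
    l_ideal_principal[OF vector_lattice_free_vl c]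
  have "sup (pprt x) (pprt (- x)) \<in> pid x"
    unfolding pprt_def
    by (intro l_ideal_freeD(2,5)[OF I(1)] l_ideal_minus[OF I(1)] principal_ideal_self)
  then show "pid (sup (pprt x) (pprt (- x))) \<subseteq> pid x" by (simp add: pid_le_iff[OF assms])
  have "x \<in> pid (sup (pprt x) (pprt (- x)))"
    by (rule l_ideal_convex[OF I(2) principal_ideal_self assms])
      (auto simp: pprt_def intro: le_supI1 le_supI2)
  then show "pid x \<subseteq> pid (sup (pprt x) (pprt (- x)))" by (simp add: pid_le_iff[OF c])
qed

lemma isLub_pid:
  assumes "x \<in> car" "y \<in> car" "0 \<le> x" "0 \<le> y"
  shows "isLub (Idc (free_vl I)) {pid x, pid y} (pid (sup x y))"
proof -
  have c: "sup x y \<in> car" by (rule free_vl_closed(5)[OF assms(1,2)])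
  note I = l_ideal_principal[OF vector_lattice_free_vl c]
  have "- x \<le> sup x y" "- y \<le> sup x y"
    using assms(3,4) by (meson le_supI1 le_supI2 neg_le_0_iff_le order_trans)+
  then have "x \<in> pid (sup x y)" "y \<in> pid (sup x y)"
    using assms by (auto intro!: l_ideal_convex[OF I principal_ideal_self])
  moreover have "pid (sup x y) \<subseteq> pid w" if "w \<in> car" "pid x \<subseteq> pid w" "pid y \<subseteq> pid w" for w
    using l_ideal_freeD(5)[OF l_ideal_principal[OF vector_lattice_free_vl that(1)]] that(2,3)
    unfolding pid_le_iff[OF that(1)] pid_le_iff[OF c] by (simp add: pid_le_iff[OF that(1)])
  ultimately show ?thesis
    unfolding isLub_pair Idc_def using c by (auto simp: pid_le_iff[OF c])
qed

lemma pid_inf_subset: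
  assumes "x \<in> car" "y \<in> car" "0 \<le> x" "0 \<le> y"
  shows "pid (inf x y) \<subseteq> pid x" "pid (inf x y) \<subseteq> pid y"
proof -
  have c: "inf x y \<in> car" by (rule free_vl_closed(6)[OF assms(1,2)])
  have 0: "- inf x y \<le> 0" using assms(3,4) by (simp add: neg_le_0_iff_le)
  note convex = l_ideal_convex[OF l_ideal_principal[OF vector_lattice_free_vl] principal_ideal_self c]
  show "pid (inf x y) \<subseteq> pid x" "pid (inf x y) \<subseteq> pid y"
    unfolding pid_le_iff[OF assms(1)] pid_le_iff[OF assms(2)]
    by (rule convex[OF assms(1) inf_le1 order_trans[OF 0 assms(3)]],
        rule convex[OF assms(2) inf_le2 order_trans[OF 0 assms(4)]])
qed

text \<open>If \<open>w\<close> lies in both ideals, its absolute value is at most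
  \<open>fsmul c x\<close> and at most \<open>fsmul c y\<close> for a common \<open>c\<close>, hence
  at most \<open>fsmul c (inf x y)\<close>.\<close>

lemma isGlb_pid:
  assumes "x \<in> car" "y \<in> car" "0 \<le> x" "0 \<le> y"
  shows "isGlb (Idc (free_vl I)) {pid x, pid y} (pid (inf x y))"
proof -
  have c: "inf x y \<in> car" by (rule free_vl_closed(6)[OF assms(1,2)])
  have "pid w \<subseteq> pid (inf x y)" if w: "w \<in> car" "pid w \<subseteq> pid x" "pid w \<subseteq> pid y" for w
  proof -
    have "w \<in> pid x" "w \<in> pid y" using w principal_ideal_self[of w "free_vl I"] by blast+
    then obtain a b where a: "0 \<le> a" "w \<le> fsmul a x" "- w \<le> fsmul a x"
      and b: "0 \<le> b" "w \<le> fsmul b y" "- w \<le> fsmul b y"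
      using principal_ideal_bound assms by metis
    let ?c = "max a b"
    have c0: "0 \<le> ?c" using a(1) by (simp add: le_max_iff_disj)
    have "fsmul a x \<le> fsmul ?c x" "fsmul b y \<le> fsmul ?c y"
      using assms by (auto intro: fsmul_mono_left)
    then have "w \<le> fsmul ?c (inf x y)" "- w \<le> fsmul ?c (inf x y)"
      unfolding fsmul_sup_inf(2)[OF c0] using a b by (blast intro: le_infI order_trans)+
    moreover have I: "l_ideal (free_vl I) (pid (inf x y))"
      by (rule l_ideal_principal[OF vector_lattice_free_vl c])
    moreover have "fsmul ?c (inf x y) \<in> pid (inf x y)"
      by (intro l_ideal_freeD(4)[OF I] principal_ideal_self)
    ultimately have "w \<in> pid (inf x y)" using w(1) l_ideal_convex[of I "pid (inf x y)"] by blast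
    then show ?thesis by (simp add: pid_le_iff[OF c])
  qed
  then show ?thesis
    unfolding isGlb_pair Idc_def using c pid_inf_subset[OF assms] by auto
qed

lemma pid_zero: "pid 0 = {0}"
proof -
  have "l_ideal (free_vl I) {0}"
    using free_vl_closed(1)[of I] by (auto simp: l_ideal_free_vl)
  then show ?thesis
    using principal_ideal_least[of "free_vl I" "{0}" 0] principal_ideal_self[of 0 "free_vl I"] by blast
qed

section \<open>From homomorphisms to valuations\<close>

context
  fixes f :: "('i, 'k::{division_ring,linordered_ring}) fvl set \<Rightarrow> 'l::{distrib_lattice,bounded_lattice_bot}"
  assumes f: "zero_lattice_hom_on (Idc (free_vl I)) f"
begin

lemma hom_sup: "x \<in> car \<Longrightarrow> y \<in> car \<Longrightarrow> 0 \<le> x \<Longrightarrow> 0 \<le> y \<Longrightarrow> f (pid (sup x y)) = sup (f (pid x)) (f (pid y))"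
  using f isLub_pid[of x y] unfolding zero_lattice_hom_on_def lattice_hom_on_def Idc_def by blast

lemma hom_inf: "x \<in> car \<Longrightarrow> y \<in> car \<Longrightarrow> 0 \<le> x \<Longrightarrow> 0 \<le> y \<Longrightarrow> f (pid (inf x y)) = inf (f (pid x)) (f (pid y))"
  using f isGlb_pid[of x y] unfolding zero_lattice_hom_on_def lattice_hom_on_def Idc_def by blast

lemma hom_zero: "f (pid 0) = bot"
proof -
  have "pid 0 \<in> Idc (free_vl I)" using free_vl_closed(1) by (auto simp: Idc_def)
  moreover have "pid 0 \<le> A" if "A \<in> Idc (free_vl I)" for A
    using that l_ideal_freeD(2)[OF l_ideal_principal[OF vector_lattice_free_vl]]
    unfolding pid_zero Idc_def by auto
  moreover have "\<forall>z\<in>Idc (free_vl I). (\<forall>A\<in>Idc (free_vl I). z \<le> A) \<longrightarrow> f z = bot"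
    using f unfolding zero_lattice_hom_on_def by (rule conjunct2)
  ultimately show ?thesis by blast
qed

lemma hom_mono:
  assumes "x \<in> car" "y \<in> car" "x \<in> pid y"
  shows "f (pid x) \<le> f (pid y)"
proof -
  have "isLub (Idc (free_vl I)) {pid x, pid y} (pid y)"
    using assms by (auto simp: isLub_pair Idc_def pid_le_iff)
  then have "f (pid y) = sup (f (pid x)) (f (pid y))"
    using f assms unfolding zero_lattice_hom_on_def lattice_hom_on_def Idc_def by blast
  then show ?thesis by (metis sup_ge1)
qed

text \<open>The positive parts of \<open>a\<close> and \<open>- a\<close> are disjoint, the positive
  part of a sum is at most twice the join of the positive parts, and positive multiples generate the
  same ideal.\<close>

lemma valuation_hom: "fvl.valuation (lin_span I) (\<lambda>a. f (pid (pprt a)))"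
  unfolding fvl.valuation_def
proof (intro conjI ballI allI impI)
  have lin_car: "a \<in> car" if "a \<in> lin_span I" for a :: "('i, 'k) fvl"
    using that lattice_span_lin vcar_free_vl_eq_lattice_span by blast
  note pprt = pprt_car
  fix a :: "('i, 'k) fvl" assume "a \<in> lin_span I"
  then have a: "a \<in> car" "- a \<in> car" using lin_car free_vl_closed by blast+
  have "inf (f (pid (pprt a))) (f (pid (pprt (- a)))) = f (pid (inf (pprt a) (pprt (- a))))"
    using hom_inf[OF pprt[OF a(1)] pprt[OF a(2)]] by simp
  also have "inf (pprt a) (pprt (- a)) = 0"
  proof -
    have "pprt (- a) = pprt a - a" using prts[of a] by (simp add: pprt_neg algebra_simps)
    then have "inf (pprt a) (pprt (- a)) = pprt a + inf 0 (- a)"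
      by (simp add: add_inf_distrib_left)
    also have "\<dots> = 0"
      using nprt_neg[of a] unfolding nprt_def by (simp add: inf_commute)
    finally show ?thesis .
  qed
  finally show "inf (f (pid (pprt a))) (f (pid (pprt (- a)))) = bot"
    by (simp add: hom_zero)
  show "f (pid (pprt (fsmul k a))) = f (pid (pprt a))" if k: "0 < k" for k
  proof -
    have mono: "f (pid (pprt (fsmul l b))) \<le> f (pid (pprt b))" if "b \<in> car" "0 < l" for l b
    proof (rule hom_mono)
      show "pprt (fsmul l b) \<in> car" "pprt b \<in> car" using that pprt free_vl_closed by blast+
      have "pprt (fsmul l b) = fsmul l (pprt b)"
        using that(2) by (simp add: pprt_def fsmul_sup_inf)
      then show "pprt (fsmul l b) \<in> pid (pprt b)"
        using l_ideal_freeD(4)[OF l_ideal_principal[OF vector_lattice_free_vl \<open>pprt b \<in> car\<close>] principal_ideal_self]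
        by simp
    qed
    have "fsmul (inverse k) (fsmul k a) = a"
      using less_imp_neq[OF k] by (simp add: fvl.one_scale flip: fvl.mult_scale)
    then show ?thesis
      using mono[OF a(1) k] mono[OF free_vl_closed(4)[OF a(1), of k] inverse_pos[OF k]]
      by (simp add: antisym)
  qed
  fix b :: "('i, 'k) fvl" assume "b \<in> lin_span I"
  then have b: "b \<in> car" using lin_car by blast
  have c: "sup (pprt a) (pprt b) \<in> car" by (rule free_vl_closed(5)[OF pprt[OF a(1)] pprt[OF b]])
  note I = l_ideal_principal[OF vector_lattice_free_vl c]
  have "f (pid (pprt (a + b))) \<le> f (pid (sup (pprt a) (pprt b)))"
  proof (rule hom_mono)
    show "pprt (a + b) \<in> car" by (rule pprt[OF free_vl_closed(2)[OF a(1) b]])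
    show "pprt (a + b) \<in> pid (sup (pprt a) (pprt b))"
    proof (rule l_ideal_convex[OF I _ \<open>pprt (a + b) \<in> car\<close>])
      show "sup (pprt a) (pprt b) + sup (pprt a) (pprt b) \<in> pid (sup (pprt a) (pprt b))"
        by (intro l_ideal_freeD(3)[OF I] principal_ideal_self)
      have "a \<le> sup (pprt a) (pprt b)" "b \<le> sup (pprt a) (pprt b)"
        by (auto simp: pprt_def intro: le_supI1 le_supI2)
      moreover have 0: "0 \<le> sup (pprt a) (pprt b)" by (auto intro: le_supI1)
      ultimately show le: "pprt (a + b) \<le> sup (pprt a) (pprt b) + sup (pprt a) (pprt b)"
        unfolding pprt_def[of "a + b"] by (intro sup_least add_mono add_nonneg_nonneg)
      show "- pprt (a + b) \<le> sup (pprt a) (pprt b) + sup (pprt a) (pprt b)"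
        using add_nonneg_nonneg[OF 0 0] by (meson neg_le_0_iff_le order_trans zero_le_pprt)
    qed
  qed (rule c)
  also have "\<dots> = sup (f (pid (pprt a))) (f (pid (pprt b)))"
    using a b pprt by (intro hom_sup) auto
  finally show "f (pid (pprt (a + b))) \<le> sup (f (pid (pprt a))) (f (pid (pprt b)))" .
qed

end

end

section \<open>Valuations and homomorphisms\<close>

text \<open>The new variables \<open>e n\<close> are adjoined one at a time, and the
  \<open>n\<close>-th receives as its value the \<open>n\<close>-th entry of an enumeration
  \<open>s\<close> of the whole target. Its negative receives \<open>bot\<close>. The stages agree
  on earlier spans, so they have a common extension.\<close>

lemma valuation_extend_lin:
  fixes h :: "('i, 'k::{division_ring,linordered_ring}) fvl \<Rightarrow> 'l::completely_normal_lattice"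
  assumes "countable (UNIV :: 'k set)" "countable I" "countable J" "I \<subseteq> J" "infinite (J - I)"
    and L: "countable (UNIV :: 'l set)" and h: "fvl.valuation (lin_span I) h"
  obtains h' where "fvl.valuation (lin_span J) h'" "\<And>a. a \<in> lin_span I \<Longrightarrow> h' a = h a"
    "\<And>l. \<exists>j\<in>J. h' (fgen j) = l \<and> h' (- fgen j) = bot"
proof -
  define e where "e = from_nat_into (J - I)"
  have "bij_betw e UNIV (J - I)"
    unfolding e_def using assms(3,5) by (intro bij_betw_from_nat_into) auto
  then have e: "inj e" "range e = J - I" by (auto simp: bij_betw_def)
  define s :: "nat \<Rightarrow> 'l" where "s = from_nat_into UNIV"
  have s: "range s = UNIV" unfolding s_def by (rule range_from_nat_into[OF _ L]) simp
  define K where "K n = I \<union> e ` {..<n}" for n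
  have K_Suc: "K (Suc n) = insert (e n) (K n)" and e_K: "e n \<notin> K n" for n
    using e by (auto simp: K_def lessThan_Suc dest: injD)
  have K_mono: "lin_span (K m) \<subseteq> lin_span (K n)" if "m \<le> n" for m n
    using that by (intro lin_mono) (auto simp: K_def)
  have "\<exists>H. \<forall>n. (fvl.valuation (lin_span (K n)) (H n) \<and> (n = 0 \<longrightarrow> H n = h)) \<and>
      ((\<forall>a\<in>lin_span (K n). H (Suc n) a = H n a) \<and> H (Suc n) (fgen (e n)) = s n \<and>
        H (Suc n) (- fgen (e n)) = bot)"
  proof (rule dependent_nat_choice)
    show "\<exists>H. fvl.valuation (lin_span (K 0)) H \<and> (0 = (0::nat) \<longrightarrow> H = h)"
      using h by (simp add: K_def)
    fix H :: "('i, 'k) fvl \<Rightarrow> 'l" and n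
    assume H: "fvl.valuation (lin_span (K n)) H \<and> (n = 0 \<longrightarrow> H = h)"
    have W': "(lin_span (K (Suc n)) :: ('i, 'k) fvl set) = {fsmul a (fgen (e n)) + c | a c. c \<in> lin_span (K n)}"
      by (simp add: K_Suc lin_insert)
    have "countable (lin_span (K n) :: ('i, 'k) fvl set)"
      using assms by (intro countable_lin) (simp_all add: K_def)
    \<comment> \<open>As \<open>e n\<close> is not among the variables used so far, its coordinate
      can serve as \<open>\<kappa>\<close>.\<close>
    moreover have "coordinate (e n) y = 0" if "y \<in> lin_span (K n)" for y :: "('i, 'k) fvl"
      using that e_K by (rule coordinate_lin)
    ultimately obtain H' where "fvl.valuation (lin_span (K (Suc n))) H'" "\<And>y. y \<in> lin_span (K n) \<Longrightarrow> H' y = H y"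
      "H' (fgen (e n)) = s n" "H' (- fgen (e n)) = bot"
      using fvl.valuation_extend[OF conjunct1[OF H] subspace_lin _ W', of "coordinate (e n)" "s n"]
      by (auto simp: coordinate_simps)
    then show "\<exists>H'. (fvl.valuation (lin_span (K (Suc n))) H' \<and> (Suc n = 0 \<longrightarrow> H' = h)) \<and>
        ((\<forall>a\<in>lin_span (K n). H' a = H a) \<and> H' (fgen (e n)) = s n \<and> H' (- fgen (e n)) = bot)"
      by blast
  qed
  then obtain H where H: "\<And>n. fvl.valuation (lin_span (K n)) (H n)"
    and ext: "\<And>n a. a \<in> lin_span (K n) \<Longrightarrow> H (Suc n) a = H n a"
    and val: "\<And>n. H (Suc n) (fgen (e n)) = s n \<and> H (Suc n) (- fgen (e n)) = bot"
    and H0: "H 0 = h"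
    by blast
  have stable: "H n a = H m a" if "m \<le> n" "a \<in> lin_span (K m)" for m n a
    using that
  proof (induction n rule: dec_induct)
    case (step n)
    then show ?case using ext[of a n] K_mono[of m n] by auto
  qed simp
  have cover: "\<exists>n. a \<in> lin_span (K n)" if "a \<in> lin_span J" for a :: "('i, 'k) fvl"
    using that
  proof induction
    case (lin_gen i)
    then obtain n where "i \<in> K n" using e(2) unfolding K_def by blast
    then show ?case by (intro exI[of _ n] lin_span.lin_gen)
  next
    case (lin_add x y)
    then obtain m n where "x \<in> lin_span (K m)" "y \<in> lin_span (K n)" by blast
    then have "x \<in> lin_span (K (max m n))" "y \<in> lin_span (K (max m n))"
      using K_mono[of m "max m n"] K_mono[of n "max m n"] by auto
    then show ?case by (intro exI[of _ "max m n"] lin_span.lin_add)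
  next
    case (lin_smul x a)
    then obtain n where "x \<in> lin_span (K n)" by blast
    then show ?case by (intro exI[of _ n] lin_span.lin_smul)
  qed (intro exI lin_span.lin_zero)
  \<comment> \<open>The first stage containing \<open>a\<close> is used; by \<open>stable\<close>
    any later one gives the same value.\<close>
  define h' where "h' a = H (LEAST n. a \<in> lin_span (K n)) a" for a
  have h': "h' a = H n a" if "a \<in> lin_span (K n)" for a n
    using stable[OF Least_le[of "\<lambda>n. a \<in> lin_span (K n)"]] that LeastI[of "\<lambda>n. a \<in> lin_span (K n)"]
    unfolding h'_def by metis
  show thesis
  proof (rule that)
    show "fvl.valuation (lin_span J) h'"
      unfolding fvl.valuation_def
    proof (intro conjI ballI allI impI)
      fix a b :: "('i, 'k) fvl" assume a: "a \<in> lin_span J" and b: "b \<in> lin_span J"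
      obtain m n where mn: "a \<in> lin_span (K m)" "b \<in> lin_span (K n)" using cover a b by blast
      then have *: "a \<in> lin_span (K (max m n))" "b \<in> lin_span (K (max m n))"
        using K_mono[of m "max m n"] K_mono[of n "max m n"] by auto
      show "h' (a + b) \<le> sup (h' a) (h' b)"
        using H[of "max m n"] * h'[OF *(1)] h'[OF *(2)] h'[OF lin_add[OF *]]
        unfolding fvl.valuation_def by metis
    next
      fix a :: "('i, 'k) fvl" assume "a \<in> lin_span J"
      then obtain n where a: "a \<in> lin_span (K n)" using cover by blast
      show "inf (h' a) (h' (- a)) = bot"
        using H[of n] a h'[OF a] h'[OF fvl.subspaceD(4)[OF subspace_lin a]]
        unfolding fvl.valuation_def by metis
      show "h' (fsmul k a) = h' a" if "0 < k" for k
        using H[of n] a h'[OF a] h'[OF lin_smul[OF a, of k]] that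
        unfolding fvl.valuation_def by metis
    qed
    show "h' a = h a" if "a \<in> lin_span I" for a
      using h'[of a 0] H0 that by (simp add: K_def)
    show "\<exists>j\<in>J. h' (fgen j) = l \<and> h' (- fgen j) = bot" for l
    proof -
      obtain n where n: "s n = l" using s by (metis rangeE UNIV_I)
      have "fgen (e n) \<in> (lin_span (K (Suc n)) :: ('i, 'k) fvl set)"
        by (intro lin_gen) (simp add: K_Suc)
      then have "h' (fgen (e n)) = l \<and> h' (- fgen (e n)) = bot"
        using h' fvl.subspaceD(4)[OF subspace_lin] val n by metis
      moreover have "e n \<in> J" using e(2) by blast
      ultimately show ?thesis by blast
    qed
  qed
qed

section \<open>Totally ordered residue spaces\<close>

text \<open>
  The quotient by the preorder \<open>\<not> p (a - b)\<close> is avoided by letting the lattice operations pick one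
  of their arguments, so that the lattice laws only hold up to equivalence.
\<close>

definition residue_vlat :: "'i set \<Rightarrow> (('i, 'k::{division_ring,linordered_ring}) fvl \<Rightarrow> bool) \<Rightarrow>
    ('k, ('i, 'k) fvl) vlat" where
  "residue_vlat J p = \<lparr>vcar = lin_span J, vzero = 0, vadd = (+), vneg = uminus, vsmul = fsmul,
     vjoin = (\<lambda>a b. if p (a - b) then a else b), vmeet = (\<lambda>a b. if p (a - b) then b else a)\<rparr>"

text \<open>The relation \<open>le\<close> derived from \<open>p\<close> is a total preorder on the
  span of \<open>J\<close>. The free vector lattice maps to the associated ordered vector space, and
  \<open>q x\<close> says that the image of \<open>x\<close> is strictly positive. In a chain a join
  is positive when one argument is, and a meet when both are.\<close>

lemma ordered_residue:
  fixes p :: "('i, 'k::{division_ring,linordered_ring}) fvl \<Rightarrow> bool"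
  assumes opp: "\<And>a. a \<in> lin_span J \<Longrightarrow> p a \<Longrightarrow> p (- a) \<Longrightarrow> False"
    and add: "\<And>a b. a \<in> lin_span J \<Longrightarrow> b \<in> lin_span J \<Longrightarrow> p (a + b) \<Longrightarrow> p a \<or> p b"
    and smul: "\<And>k a. 0 < k \<Longrightarrow> a \<in> lin_span J \<Longrightarrow> p (fsmul k a) \<longleftrightarrow> p a"
  obtains q where "\<And>a. a \<in> lin_span J \<Longrightarrow> q a \<longleftrightarrow> p a" "\<And>x y. q (sup x y) \<longleftrightarrow> q x \<or> q y"
    "\<And>x y. q (inf x y) \<longleftrightarrow> q x \<and> q y" "\<And>x y. q (x + y) \<Longrightarrow> q x \<or> q y"
    "\<And>k x. 0 < k \<Longrightarrow> q (fsmul k x) \<longleftrightarrow> q x"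
proof -
  note S = fvl.subspaceD[OF subspace_lin[of J]]
  define le where "le a b \<longleftrightarrow> \<not> p (a - b)" for a b
  define eqv where "eqv a b \<longleftrightarrow> le a b \<and> le b a" for a b
  have total: "le a b \<or> le b a" if "a \<in> lin_span J" "b \<in> lin_span J" for a b
    using opp[of "a - b"] that S(5) by (auto simp: le_def)
  have le_refl: "le a a" if "a \<in> lin_span J" for a
    using total[OF that that] by blast
  have trans: "le a c" if "le a b" "le b c" "a \<in> lin_span J" "b \<in> lin_span J" "c \<in> lin_span J" for a b c
    using add[of "a - b" "b - c"] that S(5) by (auto simp: le_def)
  have le_add: "le (a + c) (b + d)" if "le a b" "le c d" "a \<in> lin_span J" "b \<in> lin_span J" "c \<in> lin_span J" "d \<in> lin_span J"
    for a b c d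
    using add[of "a - b" "c - d"] that S(5) by (auto simp: le_def algebra_simps)
  have le_neg: "le (- b) (- a)" if "le a b" for a b
    using that by (simp add: le_def)
  have le_smul: "le (fsmul k a) (fsmul k b)" if "0 < k" "le a b" "a \<in> lin_span J" "b \<in> lin_span J" for k a b
    using smul[OF that(1) S(5)[OF that(3,4)]] that(2) by (simp add: le_def fvl.scale_diff)
  let ?R = "residue_vlat J p"
  have R: "vzero ?R = 0" "vadd ?R a b = a + b" "vneg ?R a = - a" "vsmul ?R k a = fsmul k a"
    "vjoin ?R a b = (if le a b then b else a)" "vmeet ?R a b = (if le a b then a else b)" for a b k
    by (simp_all add: residue_vlat_def le_def)
  define jn where "jn a b = (if le a b then b else a)" for a b
  define mt where "mt a b = (if le a b then a else b)" for a b
  have jn_in: "jn a b \<in> lin_span J" "mt a b \<in> lin_span J" if "a \<in> lin_span J" "b \<in> lin_span J" for a b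
    using that by (simp_all add: jn_def mt_def)
  have jn_le: "le (jn a b) c \<longleftrightarrow> le a c \<and> le b c" "le c (jn a b) \<longleftrightarrow> le c a \<or> le c b"
    "le (mt a b) c \<longleftrightarrow> le a c \<or> le b c" "le c (mt a b) \<longleftrightarrow> le c a \<and> le c b"
    if "a \<in> lin_span J" "b \<in> lin_span J" "c \<in> lin_span J" for a b c
    unfolding jn_def mt_def using total trans that by (auto split: if_splits) metis+
  \<comment> \<open>The congruence \<open>vleq\<close> may pass through terms with variables outside
    \<open>J\<close>; sending these to 0 keeps every value in the span.\<close>
  define ev where "ev = term_eval ?R (\<lambda>i. if i \<in> J then fgen i else 0)"
  have ev: "ev (Var i) = (if i \<in> J then fgen i else 0)" "ev Zero = 0" "ev (Add s t) = ev s + ev t"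
    "ev (Neg s) = - ev s" "ev (Smul k s) = fsmul k (ev s)"
    "ev (Join s t) = jn (ev s) (ev t)" "ev (Meet s t) = mt (ev s) (ev t)" for i s t k
    by (simp_all add: ev_def R jn_def mt_def)
  have ev_in: "ev t \<in> lin_span J" for t
    by (induction t) (simp_all add: ev S jn_in lin_gen)
  note J = ev_in S jn_in
  have eqv_smul: "eqv (fsmul k a) (fsmul k b)" if ab: "eqv a b" "a \<in> lin_span J" "b \<in> lin_span J" for k a b
  proof (cases k "0::'k" rule: linorder_cases)
    case less
    then have "0 < - k" by simp
    then show ?thesis
      using le_smul[of "- k" a b] le_smul[of "- k" b a] ab le_neg
      by (auto simp: eqv_def fvl.minus_scale) (metis minus_minus)+
  next
    case equal
    then show ?thesis using le_refl[OF S(1)] by (simp add: eqv_def)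
  next
    case greater
    then show ?thesis using le_smul[of k] ab by (auto simp: eqv_def)
  qed
  have eqv_refl: "eqv a a" if "a \<in> lin_span J" for a
    using le_refl[OF that] by (simp add: eqv_def)
  have ev_eqv: "eqv (ev s) (ev t)" if "vleq s t" for s t
    \<comment> \<open>Each axiom is checked up to \<open>eqv\<close>, because the operations of
      \<open>residue_vlat\<close> satisfy the lattice laws only in that sense.\<close>
    using that
  proof (induction rule: vleq.induct)
    case (vleq_sym s t)
    then show ?case by (simp add: eqv_def)
  next
    case (vleq_trans s t u)
    then show ?case using trans[of "ev s" "ev t" "ev u"] trans[of "ev u" "ev t" "ev s"] by (simp add: eqv_def J)
  next
    case (cong_Add s s' t t')
    then show ?case by (simp add: eqv_def ev le_add J)
  next
    case (cong_Neg s s')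
    then show ?case by (simp add: eqv_def ev le_neg)
  next
    case (cong_Smul s s' k)
    then show ?case by (simp add: ev eqv_smul J)
  next
    case (cong_Join s s' t t')
    \<comment> \<open>The conjunctive rules \<open>jn_le(1,4)\<close> go first. In the opposite
      order one disjunct would have to serve both arguments of a join at once.\<close>
    then show ?case by (simp add: eqv_def ev jn_le(1,4) J) (simp add: jn_le(2,3) J)
  next
    case (cong_Meet s s' t t')
    then show ?case by (simp add: eqv_def ev jn_le(1,4) J) (simp add: jn_le(2,3) J)
  next
    case (ax_add_mono s t u)
    then have "le (ev s) (ev t)" by (simp add: eqv_def ev jn_le(1,4) J)
    then show ?case by (simp add: eqv_def ev jn_le(1,4) J le_add le_refl) (simp add: jn_le(2,3) J le_add le_refl)
  next
    case (ax_smul_nonneg k s)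
    then have "le 0 (ev s)" by (simp add: eqv_def ev jn_le(1,4) J)
    then have "le 0 (fsmul k (ev s))"
      using le_smul[of k 0 "ev s"] ax_smul_nonneg(1) le_refl[OF S(1)]
      by (cases "k = 0") (simp_all add: J less_le)
    then show ?case by (simp add: eqv_def ev jn_le(1,4) J le_refl) (simp add: jn_le(2,3) J le_refl)
  qed (simp_all add: ev eqv_refl J fvl.scale_add fvl.add_scale fvl.mult_scale fvl.one_scale add.assoc,
      simp_all add: eqv_def jn_le(1,4) J, simp_all add: jn_le(2,3) J le_refl add.commute)
  define E where "E x = ev (rep_fvl x)" for x
  have E_in: "E x \<in> lin_span J" for x by (simp add: E_def J)
  have E_abs: "eqv (E (abs_fvl t)) (ev t)" for t
    unfolding E_def
    by (rule ev_eqv) (simp add: abs_fvl_eq_iff[symmetric] Quotient_abs_rep[OF Quotient_fvl])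
  have repr: "x = abs_fvl (rep_fvl x)" for x :: "('i, 'k) fvl"
    by (simp add: Quotient_abs_rep[OF Quotient_fvl])
  have E: "eqv (E (x + y)) (E x + E y)" "eqv (E (fsmul k x)) (fsmul k (E x))"
    "eqv (E (sup x y)) (jn (E x) (E y))" "eqv (E (inf x y)) (mt (E x) (E y))" for x y k
    using E_abs[of "Add (rep_fvl x) (rep_fvl y)"] E_abs[of "Smul k (rep_fvl x)"]
      E_abs[of "Join (rep_fvl x) (rep_fvl y)"] E_abs[of "Meet (rep_fvl x) (rep_fvl y)"]
    by (simp_all add: ev E_def flip: abs_fvl_simps repr)
  have E_gen: "eqv (E (fgen i)) (fgen i)" if "i \<in> J" for i
    using E_abs[of "Var i"] that by (simp add: ev abs_fvl_simps(2))
  have E_zero: "eqv (E 0) 0"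
    using E_abs[of Zero] by (simp add: ev flip: abs_fvl_simps(1))
  have eqv_trans: "eqv a c" if "eqv a b" "eqv b c" "a \<in> lin_span J" "b \<in> lin_span J" "c \<in> lin_span J" for a b c
    using that trans[of a b c] trans[of c b a] by (simp add: eqv_def)
  \<comment> \<open>On the span the residue map is the identity up to \<open>eqv\<close>, which is
    why \<open>q\<close> extends \<open>p\<close>.\<close>
  have E_lin: "eqv (E a) a" if "a \<in> lin_span J" for a
    using that
  proof induction
    case (lin_add x y)
    have "eqv (E x + E y) (x + y)"
      using lin_add le_add[of "E x" x "E y" y] le_add[of x "E x" y "E y"] by (simp add: eqv_def E_in)
    with E(1)[of x y] show ?case
      by (rule eqv_trans) (intro E_in S(2) lin_add)+
  next
    case (lin_smul x k)
    have "eqv (fsmul k (E x)) (fsmul k x)"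
      by (intro eqv_smul lin_smul E_in)
    with E(2)[of k x] show ?case
      by (rule eqv_trans) (intro E_in S(3) lin_smul)+
  qed (simp_all add: E_gen E_zero)
  define q where "q x \<longleftrightarrow> \<not> le (E x) 0" for x
  have eqv_le: "le a 0 \<longleftrightarrow> le b 0" if "eqv a b" "a \<in> lin_span J" "b \<in> lin_span J" for a b
    using that trans[of a b 0] trans[of b a 0] S(1) by (auto simp: eqv_def)
  show thesis
  proof (rule that)
    show "q a \<longleftrightarrow> p a" if "a \<in> lin_span J" for a
      using eqv_le[OF E_lin[OF that] E_in that] by (simp add: q_def) (simp add: le_def)
    show "q (sup x y) \<longleftrightarrow> q x \<or> q y" "q (inf x y) \<longleftrightarrow> q x \<and> q y" for x y
      using eqv_le[OF E(3)[of x y]] eqv_le[OF E(4)[of x y]] by (auto simp: q_def jn_le J E_in)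
    show "q x \<or> q y" if "q (x + y)" for x y
      using eqv_le[OF E(1)[of x y]] le_add[of "E x" 0 "E y" 0] that
      by (auto simp: q_def J E_in)
    show "q (fsmul k x) \<longleftrightarrow> q x" if "0 < k" for k x
      using eqv_le[OF E(2)[of k x]] smul[OF that, of "E x"] by (simp add: q_def J E_in) (simp add: le_def E_in)
  qed
qed

text \<open>Taking positive parts preserves joins and meets, so agreement on linear elements spreads
  by induction over lattice combinations.\<close>

lemma valuation_hom_lattice_span:
  fixes f :: "('i, 'k::{division_ring,linordered_ring}) fvl set \<Rightarrow> 'l::{distrib_lattice,bounded_lattice_bot}"
  assumes f: "zero_lattice_hom_on (Idc (free_vl I)) f" and P: "prime_filter P"
    and q: "\<And>a. a \<in> lin_span I \<Longrightarrow> q a \<longleftrightarrow> f (principal_ideal (free_vl I) (pprt a)) \<in> P"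
      "\<And>x y. q (sup x y) \<longleftrightarrow> q x \<or> q y" "\<And>x y. q (inf x y) \<longleftrightarrow> q x \<and> q y"
    and x: "x \<in> vcar (free_vl I)"
  shows "q x \<longleftrightarrow> f (principal_ideal (free_vl I) (pprt x)) \<in> P"
proof -
  have "x \<in> lattice_span I" using x by (simp add: vcar_free_vl_eq_lattice_span)
  then show ?thesis
  proof induction
    case (lattice_span_sup x y)
    have "pprt (sup x y) = sup (pprt x) (pprt y)"
      by (simp add: pprt_def sup_assoc sup_left_commute)
    moreover have "pprt x \<in> vcar (free_vl I)" "pprt y \<in> vcar (free_vl I)"
      using lattice_span_sup.hyps by (simp_all add: pprt_car flip: vcar_free_vl_eq_lattice_span)
    ultimately show ?case
      using lattice_span_sup.IH by (simp add: q hom_sup[OF f] prime_filterD[OF P])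
  next
    case (lattice_span_inf x y)
    have "pprt x \<in> vcar (free_vl I)" "pprt y \<in> vcar (free_vl I)"
      using lattice_span_inf.hyps by (simp_all add: pprt_car flip: vcar_free_vl_eq_lattice_span)
    then show ?case
      using lattice_span_inf.IH by (simp add: q pprt_inf hom_inf[OF f] prime_filterD[OF P])
  qed (rule q)
qed

text \<open>At each prime filter \<open>P\<close> the valuation yields a residue space, with
  \<open>q P\<close> as its strict positivity. The value of \<open>g\<close> on the ideal of
  \<open>x\<close> is the element lying in exactly those \<open>P\<close> at which \<open>x\<close>
  has nonzero image.\<close>

lemma lattice_hom_of_valuation:
  fixes h :: "('i, 'k::{division_ring,linordered_ring}) fvl \<Rightarrow> 'l::{distrib_lattice,bounded_lattice_bot}"
  assumes h: "fvl.valuation (lin_span J) h"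
  obtains g q where "lattice_hom_on (Idc (free_vl J)) g"
    "\<And>P x. prime_filter P \<Longrightarrow> x \<in> vcar (free_vl J) \<Longrightarrow>
      g (principal_ideal (free_vl J) x) \<in> P \<longleftrightarrow> q P x \<or> q P (- x)"
    "\<And>P a. prime_filter P \<Longrightarrow> a \<in> lin_span J \<Longrightarrow> q P a \<longleftrightarrow> h a \<in> P"
    "\<And>P x y. prime_filter P \<Longrightarrow> q P (sup x y) \<longleftrightarrow> q P x \<or> q P y"
    "\<And>P x y. prime_filter P \<Longrightarrow> q P (inf x y) \<longleftrightarrow> q P x \<and> q P y"
proof -
  let ?car = "vcar (free_vl J) :: ('i, 'k) fvl set" and ?pid = "principal_ideal (free_vl J)"
  have "\<exists>q. prime_filter P \<longrightarrow> (\<forall>a\<in>lin_span J. q a \<longleftrightarrow> h a \<in> P) \<and>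
      (\<forall>x y. q (sup x y) \<longleftrightarrow> q x \<or> q y) \<and> (\<forall>x y. q (inf x y) \<longleftrightarrow> q x \<and> q y) \<and>
      (\<forall>x y. q (x + y) \<longrightarrow> q x \<or> q y) \<and> (\<forall>k>0. \<forall>x. q (fsmul k x) \<longleftrightarrow> q x)" for P
  proof (cases "prime_filter P")
    case True
    note val = fvl.valuation_prime_filter[OF h True]
    obtain q where "\<And>a. a \<in> lin_span J \<Longrightarrow> q a \<longleftrightarrow> h a \<in> P" "\<And>x y. q (sup x y) \<longleftrightarrow> q x \<or> q y"
      "\<And>x y. q (inf x y) \<longleftrightarrow> q x \<and> q y" "\<And>x y. q (x + y) \<Longrightarrow> q x \<or> q y"
      "\<And>k x. 0 < k \<Longrightarrow> q (fsmul k x) \<longleftrightarrow> q x"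
    proof (rule ordered_residue[of J "\<lambda>a. h a \<in> P"])
      show "h a \<in> P \<Longrightarrow> h (- a) \<in> P \<Longrightarrow> False" if "a \<in> lin_span J" for a
        using val(1)[OF that] .
      show "h (a + b) \<in> P \<Longrightarrow> h a \<in> P \<or> h b \<in> P" if "a \<in> lin_span J" "b \<in> lin_span J" for a b
        using val(2)[OF that] .
      show "h (fsmul k a) \<in> P \<longleftrightarrow> h a \<in> P" if "0 < k" "a \<in> lin_span J" for k a
        using val(3)[OF that] .
    qed (rule that; assumption)
    then show ?thesis by (intro exI[of _ q]) simp
  qed simp
  then have "\<exists>q. \<forall>P. prime_filter P \<longrightarrow> (\<forall>a\<in>lin_span J. q P a \<longleftrightarrow> h a \<in> P) \<and>
      (\<forall>x y. q P (sup x y) \<longleftrightarrow> q P x \<or> q P y) \<and> (\<forall>x y. q P (inf x y) \<longleftrightarrow> q P x \<and> q P y) \<and>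
      (\<forall>x y. q P (x + y) \<longrightarrow> q P x \<or> q P y) \<and> (\<forall>k>0. \<forall>x. q P (fsmul k x) \<longleftrightarrow> q P x)"
    by (intro choice allI)
  then obtain q where q': "\<forall>P. prime_filter P \<longrightarrow> (\<forall>a\<in>lin_span J. q P a \<longleftrightarrow> h a \<in> P) \<and>
      (\<forall>x y. q P (sup x y) \<longleftrightarrow> q P x \<or> q P y) \<and> (\<forall>x y. q P (inf x y) \<longleftrightarrow> q P x \<and> q P y) \<and>
      (\<forall>x y. q P (x + y) \<longrightarrow> q P x \<or> q P y) \<and> (\<forall>k>0. \<forall>x. q P (fsmul k x) \<longleftrightarrow> q P x)"
    by (rule exE)
  have q: "a \<in> lin_span J \<Longrightarrow> q P a \<longleftrightarrow> h a \<in> P" "q P (sup x y) \<longleftrightarrow> q P x \<or> q P y"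
    "q P (inf x y) \<longleftrightarrow> q P x \<and> q P y" "q P (x + y) \<Longrightarrow> q P x \<or> q P y"
    "0 < k \<Longrightarrow> q P (fsmul k x) \<longleftrightarrow> q P x" if "prime_filter P" for P a x y k
    using q' that by simp_all
  have q_zero: "\<not> q P 0" if "prime_filter P" for P
    using q(1)[OF that lin_zero] fvl.valuation_prime_filter_zero[OF h that lin_zero] by simp
  have q_mono: "q P y" if P: "prime_filter P" and "x \<le> y" "q P x" for P x y
    using q(2)[OF P, of x y] that by (simp add: sup_absorb2)
  have q_pprt: "q P (pprt x) \<longleftrightarrow> q P x" if "prime_filter P" for P x
    using q(2)[OF that] q_zero[OF that] by (simp add: pprt_def)
  define nz where "nz P x \<longleftrightarrow> q P x \<or> q P (- x)" for P x
  have nz_nonneg: "nz P x \<longleftrightarrow> q P x" if P: "prime_filter P" and x: "0 \<le> x" for P x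
    using q_mono[OF P, of "- x" 0] q_zero[OF P] x by (auto simp: nz_def)
  \<comment> \<open>This set is the kernel of the residue map at \<open>P\<close>. That it is an
    ideal makes nonvanishing depend on the generated ideal only.\<close>
  have ideal: "l_ideal (free_vl J) {x \<in> ?car. \<not> nz P x}" (is "l_ideal _ ?N") if P: "prime_filter P" for P
    unfolding l_ideal_free_vl
  proof (intro conjI ballI allI impI)
    show "?N \<subseteq> ?car" by blast
    show "0 \<in> ?N" using q_zero[OF P] free_vl_closed(1) by (simp add: nz_def)
  next
    fix x y assume "x \<in> ?N" "y \<in> ?N"
    then have xy: "x \<in> ?car" "y \<in> ?car" "\<not> q P x" "\<not> q P (- x)" "\<not> q P y" "\<not> q P (- y)"
      by (simp_all add: nz_def)
    have "\<not> q P (- x + - y)" using q(4)[OF P, of "- x" "- y"] xy by blast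
    then show "x + y \<in> ?N"
      using q(4)[OF P, of x y] xy free_vl_closed(2)[of x J y] by (auto simp: nz_def)
    show "sup x y \<in> ?N" "inf x y \<in> ?N"
      using xy free_vl_closed(5,6)[of x J y]
      by (simp_all add: nz_def neg_sup_eq_inf neg_inf_eq_sup q[OF P])
  next
    fix k :: 'k and x assume "x \<in> ?N"
    then have x: "x \<in> ?car" "\<not> q P x" "\<not> q P (- x)" by (simp_all add: nz_def)
    have "\<not> nz P (fsmul k x)"
    proof (cases k "0::'k" rule: linorder_cases)
      case less
      then have k: "0 < - k" by simp
      show ?thesis
        using q(5)[OF P k, of x] q(5)[OF P k, of "- x"] x
        by (simp add: nz_def fvl.minus_scale fvl.scale_minus)
    next
      case equal
      then show ?thesis using q_zero[OF P] by (simp add: nz_def)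
    next
      case greater
      then show ?thesis
        using q(5)[OF P greater, of x] q(5)[OF P greater, of "- x"] x
        by (simp add: nz_def fvl.scale_minus)
    qed
    then show "fsmul k x \<in> ?N" using free_vl_closed(4)[OF x(1)] by simp
  next
    fix x y z assume "x \<in> ?N" "y \<in> ?N" "z \<in> ?car" "x \<le> z \<and> z \<le> y"
    then show "z \<in> ?N"
      using q_mono[OF P, of z y] q_mono[OF P, of "- z" "- x"] by (auto simp: nz_def)
  qed
  have nz_mono: "nz P y" if P: "prime_filter P" and x: "x \<in> ?pid y" and y: "y \<in> ?car" and nz: "nz P x" for P x y
  proof (rule ccontr)
    assume "\<not> nz P y"
    then have "?pid y \<subseteq> {x \<in> ?car. \<not> nz P x}"
      using y by (intro principal_ideal_least[OF ideal[OF P]]) simp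
    then show False using x nz by blast
  qed
  \<comment> \<open>For linear \<open>x\<close> the element is \<open>h x\<close>; joins and meets
    of such elements cover all other \<open>x\<close>, so these sets of prime filters always come
    from the lattice.\<close>
  have ex_value: "\<exists>l. \<forall>P. prime_filter P \<longrightarrow> (l \<in> P \<longleftrightarrow> q P x)" if "x \<in> ?car" for x
  proof -
    have "x \<in> lattice_span J" using that by (simp add: vcar_free_vl_eq_lattice_span)
    then show ?thesis
    proof induction
      case (lattice_span_lin x)
      then show ?case using q(1) by blast
    next
      case (lattice_span_sup x y)
      then obtain l m where "\<forall>P. prime_filter P \<longrightarrow> (l \<in> P \<longleftrightarrow> q P x)"
        "\<forall>P. prime_filter P \<longrightarrow> (m \<in> P \<longleftrightarrow> q P y)" by blast
      then show ?case by (intro exI[of _ "sup l m"]) (simp add: q prime_filterD)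
    next
      case (lattice_span_inf x y)
      then obtain l m where "\<forall>P. prime_filter P \<longrightarrow> (l \<in> P \<longleftrightarrow> q P x)"
        "\<forall>P. prime_filter P \<longrightarrow> (m \<in> P \<longleftrightarrow> q P y)" by blast
      then show ?case by (intro exI[of _ "inf l m"]) (simp add: q prime_filterD)
    qed
  qed
  \<comment> \<open>Neither choice matters on \<open>Idc (free_vl J)\<close>: the memberships of
    \<open>l\<close> are independent of the generator by \<open>nz_mono\<close>, and they determine
    \<open>l\<close>.\<close>
  define g where "g A = (SOME l. \<exists>x\<in>?car. A = ?pid x \<and> (\<forall>P. prime_filter P \<longrightarrow> (l \<in> P \<longleftrightarrow> nz P x)))" for A
  have g: "g (?pid x) \<in> P \<longleftrightarrow> nz P x" if P: "prime_filter P" and x: "x \<in> ?car" for P x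
  proof -
    \<comment> \<open>Nonvanishing of \<open>x\<close> is positivity of its absolute value
      \<open>sup x (- x)\<close>.\<close>
    have "\<exists>l. \<forall>P. prime_filter P \<longrightarrow> (l \<in> P \<longleftrightarrow> q P (sup x (- x)))"
      using x by (intro ex_value free_vl_closed)
    then obtain l where "\<forall>P. prime_filter P \<longrightarrow> (l \<in> P \<longleftrightarrow> nz P x)"
      by (auto simp: q nz_def)
    then have "\<exists>l. \<exists>y\<in>?car. ?pid x = ?pid y \<and> (\<forall>P. prime_filter P \<longrightarrow> (l \<in> P \<longleftrightarrow> nz P y))"
      using x by blast
    then have "\<exists>y\<in>?car. ?pid x = ?pid y \<and> (\<forall>P. prime_filter P \<longrightarrow> (g (?pid x) \<in> P \<longleftrightarrow> nz P y))"
      unfolding g_def by (rule someI_ex)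
    then obtain y where y: "y \<in> ?car" "?pid x = ?pid y" "g (?pid x) \<in> P \<longleftrightarrow> nz P y"
      using P by blast
    have "x \<in> ?pid y" "y \<in> ?pid x"
      using y(2) principal_ideal_self[of x "free_vl J"] principal_ideal_self[of y "free_vl J"] by simp_all
    then show ?thesis using nz_mono[OF P] x y by blast
  qed
  show thesis
  proof (rule that)
    have mag: "sup (pprt x) (pprt (- x)) \<in> ?car" "0 \<le> sup (pprt x) (pprt (- x))"
      "?pid (sup (pprt x) (pprt (- x))) = ?pid x" if "x \<in> ?car" for x
    proof -
      show "sup (pprt x) (pprt (- x)) \<in> ?car"
        using that by (intro free_vl_closed pprt_car)
      show "0 \<le> sup (pprt x) (pprt (- x))" by (auto intro: le_supI1)
    qed (rule pid_sup_pprt[OF that])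
    have g_mag: "g (?pid x) \<in> P \<longleftrightarrow> q P x" if "prime_filter P" "x \<in> ?car" "0 \<le> x" for P x
      using g[OF that(1,2)] nz_nonneg[OF that(1,3)] by simp
    show "lattice_hom_on (Idc (free_vl J)) g"
      unfolding lattice_hom_on_def
    proof (intro conjI ballI allI impI)
      fix A B C :: "('i, 'k) fvl set" assume "A \<in> Idc (free_vl J)" "B \<in> Idc (free_vl J)"
      then obtain a b where a: "a \<in> ?car" "A = ?pid a" and b: "b \<in> ?car" "B = ?pid b"
        by (auto simp: Idc_def)
      \<comment> \<open>Nonnegative generators are needed, since only for them are joins and meets
        of ideals generated by joins and meets.\<close>
      define x where "x = sup (pprt a) (pprt (- a))"
      define y where "y = sup (pprt b) (pprt (- b))"
      have x: "x \<in> ?car" "0 \<le> x" "A = ?pid x" and y: "y \<in> ?car" "0 \<le> y" "B = ?pid y"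
        using mag[OF a(1)] mag[OF b(1)] a(2) b(2) by (simp_all add: x_def y_def)
      show "g C = sup (g A) (g B)" if "isLub (Idc (free_vl J)) {A, B} C"
      proof -
        have "C = ?pid (sup x y)"
          using that isLub_pid[OF x(1) y(1) x(2) y(2)] unfolding x(3) y(3) isLub_pair
          by (intro antisym) auto
        then have "g C \<in> P \<longleftrightarrow> q P (sup x y)" if "prime_filter P" for P
          using that x(1,2) y(1,2) by (simp add: g_mag free_vl_closed le_supI1)
        moreover have "g A \<in> P \<longleftrightarrow> q P x" "g B \<in> P \<longleftrightarrow> q P y" if "prime_filter P" for P
          unfolding x(3) y(3) using that x(1,2) y(1,2) by (simp_all add: g_mag)
        ultimately show ?thesis
          by - (rule prime_filter_eqI, simp add: prime_filterD q)
      qed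
      show "g C = inf (g A) (g B)" if "isGlb (Idc (free_vl J)) {A, B} C"
      proof -
        have "C = ?pid (inf x y)"
          using that isGlb_pid[OF x(1) y(1) x(2) y(2)] unfolding x(3) y(3) isGlb_pair
          by (intro antisym) auto
        then have "g C \<in> P \<longleftrightarrow> q P (inf x y)" if "prime_filter P" for P
          using that x(1,2) y(1,2) by (simp add: g_mag free_vl_closed le_supI1)
        moreover have "g A \<in> P \<longleftrightarrow> q P x" "g B \<in> P \<longleftrightarrow> q P y" if "prime_filter P" for P
          unfolding x(3) y(3) using that x(1,2) y(1,2) by (simp_all add: g_mag)
        ultimately show ?thesis
          by - (rule prime_filter_eqI, simp add: prime_filterD q)
      qed
    qed
    show "g (?pid x) \<in> P \<longleftrightarrow> q P x \<or> q P (- x)" if "prime_filter P" "x \<in> ?car" for P x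
      using g[OF that] by (simp add: nz_def)
  qed (rule q; assumption)+
qed

text \<open>Both free lattices are subsets of one quotient type, and the identity is a homomorphism
  fixing the generators, so uniqueness applies.\<close>

lemma free_incl_id:
  assumes "I \<subseteq> J" "x \<in> vcar (free_vl I)"
  shows "free_incl I J x = x"
proof -
  obtain t where t: "x = abs_fvl t" "vars t \<subseteq> I" using assms(2) by (auto simp: free_vl_simps(1))
  have "vcar (free_vl I) \<subseteq> vcar (free_vl J)"
    using assms(1) by (auto simp: free_vl_simps(1))
  then have "vl_hom (free_vl I) (free_vl J) (\<lambda>x. x)"
    by (auto simp: vl_hom_def)
  then have "free_incl I J (abs_fvl t) = abs_fvl t"
    using free_incl[OF assms(1)] t(2) by (intro vl_hom_free_unique[of I "free_vl J"]) auto
  then show ?thesis using t(1) by simp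
qed

theorem theorem7p2:
  fixes I J :: "'i set"
    and f :: "('i, 'k::{division_ring,linordered_ring}) fvl set
               \<Rightarrow> 'm::{distrib_lattice,bounded_lattice_bot}"
    and \<phi> :: "'m \<Rightarrow> 'l::completely_normal_lattice"
  assumes "countable (UNIV :: 'k set)"
    and "countable I" and "countable J"
    and "I \<subset> J" and "infinite (J - I)"
    and "countable (UNIV :: 'l set)"
    and "zero_lattice_hom_on UNIV \<phi>"
    and "zero_lattice_hom_on (Idc (free_vl I)) f"
  shows "\<exists>g :: ('i, 'k) fvl set \<Rightarrow> 'l.
    lattice_hom_on (Idc (free_vl J)) g \<and> g ` Idc (free_vl J) = UNIV \<and>
    (\<forall>A\<in>Idc (free_vl I). g (eta I J A) = \<phi> (f A))"
proof -
  let ?I = "principal_ideal (free_vl I)" and ?J = "principal_ideal (free_vl J)"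
  have IJ: "I \<subseteq> J" using assms(4) by blast
  \<comment> \<open>The composite of \<open>f\<close> and \<open>\<phi>\<close> is extended as a
    single homomorphism into the completely normal lattice.\<close>
  have hom: "zero_lattice_hom_on (Idc (free_vl I)) (\<lambda>A. \<phi> (f A))"
    using assms(8) assms(7)[unfolded zero_lattice_hom_on_UNIV]
    unfolding zero_lattice_hom_on_def lattice_hom_on_def by simp
  obtain h where h: "fvl.valuation (lin_span J) h"
    and h_I: "\<And>a. a \<in> lin_span I \<Longrightarrow> h a = \<phi> (f (?I (pprt a)))"
    and h_surj: "\<And>l. \<exists>j\<in>J. h (fgen j) = l \<and> h (- fgen j) = bot"
    using valuation_extend_lin[OF assms(1,2,3) IJ assms(5,6) valuation_hom[OF hom]] by metis
  obtain g q where g: "lattice_hom_on (Idc (free_vl J)) g"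
    "\<And>P x. prime_filter P \<Longrightarrow> x \<in> vcar (free_vl J) \<Longrightarrow> g (?J x) \<in> P \<longleftrightarrow> q P x \<or> q P (- x)"
    and q: "\<And>P a. prime_filter P \<Longrightarrow> a \<in> lin_span J \<Longrightarrow> q P a \<longleftrightarrow> h a \<in> P"
    "\<And>P x y. prime_filter P \<Longrightarrow> q P (sup x y) \<longleftrightarrow> q P x \<or> q P y"
    "\<And>P x y. prime_filter P \<Longrightarrow> q P (inf x y) \<longleftrightarrow> q P x \<and> q P y"
    by (rule lattice_hom_of_valuation[OF h]) blast
  have "l \<in> g ` Idc (free_vl J)" for l
  proof -
    obtain j where j: "j \<in> J" "h (fgen j) = l" "h (- fgen j) = bot"
      using h_surj by blast
    have "fgen j \<in> (lin_span J :: ('i, 'k) fvl set)" using j(1) by (rule lin_gen)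
    \<comment> \<open>The ideal of a generator takes the join of the values at the generator and at
      its negative, here \<open>l\<close> and \<open>bot\<close>.\<close>
    then have "g (?J (fgen j)) \<in> P \<longleftrightarrow> l \<in> P" if "prime_filter P" for P
      using g(2)[OF that fgen_in_free_vl[OF j(1)]] q(1)[OF that] j fvl.subspaceD(4)[OF subspace_lin]
        prime_filterD(3)[OF that] by metis
    then have "g (?J (fgen j)) = l" by (rule prime_filter_eqI)
    then show ?thesis using fgen_in_free_vl[OF j(1)] unfolding Idc_def by blast
  qed
  moreover have "g (eta I J A) = \<phi> (f A)" if "A \<in> Idc (free_vl I)" for A
  proof -
    obtain x where x: "x \<in> vcar (free_vl I)" "A = ?I x" using \<open>A \<in> _\<close> by (auto simp: Idc_def)
    have xJ: "x \<in> vcar (free_vl J)"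
      using x(1) IJ by (auto simp: free_vl_simps(1))
    have "g (?J x) = \<phi> (f (?I x))"
    proof (rule prime_filter_eqI)
      fix P :: "'l set" assume P: "prime_filter P"
      \<comment> \<open>On linear elements this holds because \<open>h\<close> extends the valuation
        of the composite; \<open>valuation_hom_lattice_span\<close> carries it to all of
        \<open>free_vl I\<close>.\<close>
      have "q P y \<longleftrightarrow> \<phi> (f (?I (pprt y))) \<in> P" if "y \<in> vcar (free_vl I)" for y
      proof (rule valuation_hom_lattice_span[OF hom P _ q(2)[OF P] q(3)[OF P] that])
        show "q P a \<longleftrightarrow> \<phi> (f (?I (pprt a))) \<in> P" if "a \<in> lin_span I" for a
          using q(1)[OF P] h_I[OF that] that lin_mono[OF IJ] by auto
      qed
      then have "g (?J x) \<in> P \<longleftrightarrow> \<phi> (f (?I (pprt x))) \<in> P \<or> \<phi> (f (?I (pprt (- x)))) \<in> P"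
        using g(2)[OF P xJ] x(1) free_vl_closed(3)[OF x(1)] by simp
      also have "\<dots> \<longleftrightarrow> \<phi> (f (?I (sup (pprt x) (pprt (- x))))) \<in> P"
        using hom_sup[OF hom pprt_car[OF x(1)] pprt_car[OF free_vl_closed(3)[OF x(1)]]]
        by (simp add: prime_filterD[OF P])
      finally show "g (?J x) \<in> P \<longleftrightarrow> \<phi> (f (?I x)) \<in> P"
        by (simp add: pid_sup_pprt[OF x(1)])
    qed
    then show ?thesis
      by (simp add: x(2) eta_principal[OF IJ x(1)] free_incl_id[OF IJ x(1)])
  qed
  ultimately show ?thesis using g(1) by blast
qed

end
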